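(* Let $d=2$ and let $\kappa \geq 6$ be an even integer. There is a strictly increasing sequence of energies $\{\mathcal{F}_n\}_{n=1}^{\infty}$, depending on $\kappa$, such that $\{\mathcal{F}_n\} \subset \big(\cos(\pi/\kappa)\cos(2\pi/\kappa),\ \cos(2\pi/\kappa)\big) \cap \boldsymbol{\Theta}_{\kappa}(D)$ and $\mathcal{F}_n \nearrow \cos(2\pi/\kappa)$ as $n\to\infty$. Moreover $\mathcal{F}_{2n-1} \in \boldsymbol{\Theta}_{n,\kappa}(D)$ and $\mathcal{F}_{2n} \in \boldsymbol{\Theta}_{n,\kappa}(D)$ for all $n \geq 1$.
   Context: Operators. For $d \geq 1$ let $\mathscr{H}=\ell^2(\mathbb{Z}^d)$, let $S_i$ be the shift $(S_i^{\pm 1} u)(n) = u(n_1,\ldots,n_i \mp 1,\ldots,n_d)$, $\Delta_i = \frac12 (S_i + S_i^* )$ and $D=D[d] = \prod_{i=1}^d \Delta_i$ (Molchanov--Vainberg Laplacian); $\sigma(D)=[-1,1]$. Let $(N_i u)(n) = n_i u(n)$. For $j,\kappa \in \mathbb{N}^*=\{1,2,\ldots\}$ let $A_i(j,\kappa)$ be the closure of $\frac{1}{4\mathrm{i}}\left[(S_i^{j\kappa}-S_i^{-j\kappa})N_i + N_i (S_i^{j\kappa}-S_i^{-j\kappa})\right]$ defined on compactly supported sequences, and $A_{j\kappa} = \sum_{i=1}^d A_i(j,\kappa)$ (self-adjoint). Thresholds. $\boldsymbol{\mu}_\kappa(D)$ is the set of $E \in \sigma(D)$ for which there exist a self-adjoint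 linear combination (finite or infinite) $\mathbb{A} = \sum_{j \geq 1} \rho_{j\kappa} A_{j\kappa}$, $\rho_{j\kappa}\in\mathbb{R}$, an interval $I \ni E$ and $\gamma>0$ with $1_I(D)[D,\mathrm{i}\mathbb{A}]_\circ 1_I(D) \geq \gamma 1_I(D)$, where $[D,\mathrm{i}\mathbb{A}]_\circ$ is the bounded extension of the commutator from compactly supported sequences. $\boldsymbol{\Theta}_\kappa(D) = \sigma(D)\setminus \boldsymbol{\mu}_\kappa(D)$. Let $U_n$ be the Chebyshev polynomial of the second kind, $U_{n-1}(\cos\theta)=\sin(n\theta)/\sin\theta$. For $\vec{x}=(x_1,\ldots,x_d)\in[-1,1]^d$ let $g_{j\kappa}(\vec{x}) = \sum_{i=1}^d \big(\prod_{l \neq i} x_l\big)(1-x_i^2)U_{j\kappa-1}(x_i)$, and $S_E = \{\vec{x}\in[-1,1]^d : \prod_{l=1}^d x_l = E\}$. The function $G_\kappa = \sum_j \rho_{j\kappa} g_{j\kappa}$ represents $[D,\mathrm{i}\mathbb{A}]_\circ$ by functional calculus (with $\Delta_i \leftrightarrow x_i$), and by continuity of $G_\kappa$, $E\in\boldsymbol{\mu}_\kappa(D)$ iff $G_\kappa>0$ on $S_E$ for some such $\mathbb{A}$. $\boldsymbol{\Theta}_{0,\kappa}(D)$ is the set of $E\in[-1,1]$ such that there is $\vec{x}\in S_E$ with $g_{j\kappa}(\vec{x})=0$ for all $j\in\mathbb{N}^*$. For $m\in\mathbb{N}^*$, $\boldsymbol{\Theta}_{m,\kappa}(D)$ is the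 set of $E\in[-1,1]$ such that there are $\vec{x}_0,\ldots,\vec{x}_m \in S_E$ and real numbers $\omega_0,\ldots,\omega_{m-1}\leq 0$ with $g_{j\kappa}(\vec{x}_m) = \sum_{q=0}^{m-1}\omega_q\, g_{j\kappa}(\vec{x}_q)$ for all $j\in\mathbb{N}^*$. *)

theory Defs
  imports "HOL-Analysis.Analysis"
begin

section \<open>Square-summable sequences on the lattice\<close>

text \<open>
  The lattice of dimension \<open>d\<close> is the type \<open>int ^ 'd\<close> with \<open>d = CARD('d)\<close>. Vectors of the Hilbert
  space are functions in the carrier \<open>l2\<close>, and operators are functions on sequences of which only
  the values on \<open>l2\<close> (for unbounded ones: on \<open>fin_supp\<close>) matter.
\<close>

type_synonym 'd seq = "int ^ 'd \<Rightarrow> complex"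
type_synonym 'd op = "'d seq \<Rightarrow> 'd seq"

definition l2 :: "('d::finite) seq set" where
  "l2 = {u. (\<lambda>n. (cmod (u n))\<^sup>2) summable_on UNIV}"

definition l2_inner :: "('d::finite) seq \<Rightarrow> 'd seq \<Rightarrow> complex" where
  "l2_inner u v = (\<Sum>\<^sub>\<infinity>n. cnj (u n) * v n)"

definition l2_norm :: "('d::finite) seq \<Rightarrow> real" where
  "l2_norm u = sqrt (\<Sum>\<^sub>\<infinity>n. (cmod (u n))\<^sup>2)"

definition l2_lim :: "(nat \<Rightarrow> ('d::finite) seq) \<Rightarrow> 'd seq \<Rightarrow> bool" where
  "l2_lim us u \<longleftrightarrow> (\<lambda>k. l2_norm (\<lambda>n. us k n - u n)) \<longlonglongrightarrow> 0"

definition fin_supp :: "('d::finite) seq set" where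
  "fin_supp = {u. finite {n. u n \<noteq> 0}}"


section \<open>Bounded operators, spectrum and spectral projections\<close>

definition bounded_op :: "('d::finite) op \<Rightarrow> bool" where
  "bounded_op T \<longleftrightarrow>
     (\<forall>u\<in>l2. T u \<in> l2) \<and>
     (\<forall>u\<in>l2. \<forall>v\<in>l2. T (\<lambda>n. u n + v n) = (\<lambda>n. T u n + T v n)) \<and>
     (\<forall>c. \<forall>u\<in>l2. T (\<lambda>n. c * u n) = (\<lambda>n. c * T u n)) \<and>
     (\<exists>C. \<forall>u\<in>l2. l2_norm (T u) \<le> C * l2_norm u)"

text \<open>The real spectrum, which is all of it for a self-adjoint operator.\<close>

definition real_spectrum :: "('d::finite) op \<Rightarrow> real set" where
  "real_spectrum T = {z. \<not> (\<exists>R. bounded_op R \<and>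
     (\<forall>u\<in>l2. R (\<lambda>n. T u n - of_real z * u n) = u \<and>
              (\<lambda>n. T (R u) n - of_real z * R u n) = u))}"

text \<open>
  \<open>spectral_measure T P\<close>: \<open>P\<close> is the projection-valued measure on the Borel sets of the real line
  that the spectral theorem attaches to the bounded self-adjoint operator \<open>T\<close>. It is unique on
  \<open>l2\<close>, since for a complex Hilbert space the quadratic form of \<open>T\<close> determines \<open>T\<close>.
\<close>

definition scalar_measure :: "(real set \<Rightarrow> ('d::finite) op) \<Rightarrow> 'd seq \<Rightarrow> real measure" where
  "scalar_measure P u =
     measure_of UNIV (sets borel) (\<lambda>X. ennreal (Re (l2_inner u (P X u))))"

definition spectral_measure :: "('d::finite) op \<Rightarrow> (real set \<Rightarrow> 'd op) \<Rightarrow> bool" where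
  "spectral_measure T P \<longleftrightarrow>
     (\<forall>X\<in>sets borel. bounded_op (P X) \<and>
        (\<forall>u\<in>l2. \<forall>v\<in>l2. l2_inner u (P X v) = l2_inner (P X u) v)) \<and>
     (\<forall>X\<in>sets borel. \<forall>Y\<in>sets borel. \<forall>u\<in>l2. P X (P Y u) = P (X \<inter> Y) u) \<and>
     (\<forall>u\<in>l2. P UNIV u = u) \<and>
     (\<forall>X :: nat \<Rightarrow> real set. range X \<subseteq> sets borel \<longrightarrow> disjoint_family X \<longrightarrow>
        (\<forall>u\<in>l2. l2_lim (\<lambda>k n. \<Sum>i<k. P (X i) u n) (P (\<Union>i. X i) u))) \<and>
     (\<forall>u\<in>l2. integrable (scalar_measure P u) (\<lambda>t. t) \<and>
        l2_inner u (T u) = of_real (\<integral>t. t \<partial>scalar_measure P u))"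

text \<open>\<open>spectral_proj T X Q\<close>: the operator \<open>Q\<close> is \<open>1\<^sub>X(T)\<close>.\<close>

definition spectral_proj :: "('d::finite) op \<Rightarrow> real set \<Rightarrow> 'd op \<Rightarrow> bool" where
  "spectral_proj T X Q \<longleftrightarrow> (\<exists>P. spectral_measure T P \<and> Q = P X)"

definition op_le :: "('d::finite) op \<Rightarrow> 'd op \<Rightarrow> bool" where
  "op_le S T \<longleftrightarrow> (\<forall>u\<in>l2. l2_inner u (\<lambda>n. T u n - S u n) \<in> \<real> \<and>
                           0 \<le> Re (l2_inner u (\<lambda>n. T u n - S u n)))"


section \<open>Unbounded operators, given by their graphs\<close>

definition graph_on :: "('d::finite) seq set \<Rightarrow> 'd op \<Rightarrow> ('d seq \<times> 'd seq) set" where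
  "graph_on X T = {(u, T u) |u. u \<in> X}"

definition graph_closure :: "(('d::finite) seq \<times> 'd seq) set \<Rightarrow> ('d seq \<times> 'd seq) set" where
  "graph_closure G = {(u, w). u \<in> l2 \<and> w \<in> l2 \<and>
     (\<exists>us ws. (\<forall>k. (us k, ws k) \<in> G) \<and> l2_lim us u \<and> l2_lim ws w)}"

definition graph_adjoint :: "(('d::finite) seq \<times> 'd seq) set \<Rightarrow> ('d seq \<times> 'd seq) set" where
  "graph_adjoint G = {(v, w). v \<in> l2 \<and> w \<in> l2 \<and>
     (\<forall>(u, z)\<in>G. l2_inner z v = l2_inner u w)}"

definition self_adjoint :: "(('d::finite) seq \<times> 'd seq) set \<Rightarrow> bool" where
  "self_adjoint G \<longleftrightarrow> graph_adjoint G = G"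


section \<open>The Molchanov--Vainberg Laplacian and the conjugate operators\<close>

text \<open>\<open>shift i k\<close> is the power \<open>S\<^sub>i\<^sup>k\<close> of the unitary shift, for any integer \<open>k\<close>.\<close>

definition shift :: "'d::finite \<Rightarrow> int \<Rightarrow> 'd op" where
  "shift i k u = (\<lambda>n. u (n - axis i k))"

definition Delta :: "'d::finite \<Rightarrow> 'd op" where
  "Delta i u = (\<lambda>n. (shift i 1 u n + shift i (-1) u n) / 2)"

lemma Delta_comp_fun_commute: "comp_fun_commute (\<lambda>(i::'d::finite) T. Delta i \<circ> T)"
proof
  fix i j :: 'd
  have "Delta i (Delta j u) = Delta j (Delta i u)" for u
    by (auto simp: Delta_def shift_def fun_eq_iff algebra_simps add_divide_distrib)
  then show "(\<lambda>T. Delta j \<circ> T) \<circ> (\<lambda>T. Delta i \<circ> T) = (\<lambda>T. Delta i \<circ> T) \<circ> (\<lambda>T. Delta j \<circ> T)"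
    by (simp add: fun_eq_iff)
qed

text \<open>The product of the commuting operators \<open>Delta i\<close>, in no particular order.\<close>

definition MV :: "('d::finite) op" where
  "MV = Finite_Set.fold (\<lambda>i T. Delta i \<circ> T) id UNIV"

lemma MV_2: "MV = Delta (1::2) \<circ> Delta 2"
proof -
  interpret comp_fun_commute "\<lambda>(i::2) T. Delta i \<circ> T"
    by (rule Delta_comp_fun_commute)
  have "(1::2) \<noteq> 2" by simp
  then show ?thesis
    unfolding MV_def UNIV_2 by simp
qed

definition position :: "'d::finite \<Rightarrow> 'd op" where
  "position i u = (\<lambda>n. of_int (n $ i) * u n)"

text \<open>
  \<open>A_coord i k\<close> and \<open>A_sum k\<close> are \<open>A\<^sub>i(j,\<kappa>)\<close> and \<open>A\<^sub>j\<^sub>\<kappa>\<close> on compactly supported sequences, with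
  \<open>k = j\<kappa>\<close>.
\<close>

definition shift_diff :: "'d::finite \<Rightarrow> nat \<Rightarrow> 'd op" where
  "shift_diff i k u = (\<lambda>n. shift i (int k) u n - shift i (- int k) u n)"

definition A_coord :: "'d::finite \<Rightarrow> nat \<Rightarrow> 'd op" where
  "A_coord i k u =
     (\<lambda>n. (shift_diff i k (position i u) n + position i (shift_diff i k u) n) / (4 * \<i>))"

definition A_sum :: "nat \<Rightarrow> ('d::finite) op" where
  "A_sum k u = (\<lambda>n. \<Sum>i\<in>UNIV. A_coord i k u n)"

text \<open>
  \<open>conj_comb \<kappa> \<rho> A\<close>: on compactly supported sequences \<open>A\<close> is the linear combination
  of the \<open>A_sum (j * \<kappa>)\<close>, \<open>j \<ge> 1\<close>, with coefficients \<open>\<rho> j\<close>. An infinite series converges in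
  the norm of \<open>l2\<close>; \<open>\<rho>\<close> of finite support gives a finite combination. The operator
  required to be self-adjoint is the closure of \<open>A\<close> from compactly supported sequences.
\<close>

definition conj_comb :: "nat \<Rightarrow> (nat \<Rightarrow> real) \<Rightarrow> ('d::finite) op \<Rightarrow> bool" where
  "conj_comb \<kappa> \<rho> A \<longleftrightarrow>
     (\<forall>u\<in>fin_supp. A u \<in> l2 \<and>
        l2_lim (\<lambda>J n. \<Sum>j=1..J. of_real (\<rho> j) * A_sum (j * \<kappa>) u n) (A u)) \<and>
     self_adjoint (graph_closure (graph_on fin_supp A))"

text \<open>\<open>commutator_ext T A B\<close>: \<open>B\<close> is the bounded extension of \<open>[T, \<i>A]\<close>.\<close>

definition commutator_ext :: "('d::finite) op \<Rightarrow> 'd op \<Rightarrow> 'd op \<Rightarrow> bool" where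
  "commutator_ext T A B \<longleftrightarrow> bounded_op B \<and>
     (\<forall>u\<in>fin_supp. B u = (\<lambda>n. \<i> * (T (A u) n - A (T u) n)))"


section \<open>Thresholds\<close>

text \<open>
  The interval around \<open>E\<close> is open: over the degenerate interval \<open>{E}\<close> the
  spectral projection vanishes and the Mourre estimate would be void.
\<close>

definition mourre_set :: "('d::finite) itself \<Rightarrow> nat \<Rightarrow> real set" where
  "mourre_set TYPE('d) \<kappa> = {E \<in> real_spectrum (MV :: 'd op).
     \<exists>\<rho> (A :: 'd op) B Q a b \<gamma>.
       conj_comb \<kappa> \<rho> A \<and> commutator_ext MV A B \<and>
       a < E \<and> E < b \<and> spectral_proj MV {a<..<b} Q \<and>
       \<gamma> > 0 \<and> op_le (\<lambda>u n. of_real \<gamma> * Q u n) (Q \<circ> B \<circ> Q)}"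

definition Theta :: "('d::finite) itself \<Rightarrow> nat \<Rightarrow> real set" where
  "Theta TYPE('d) \<kappa> = real_spectrum (MV :: 'd op) - mourre_set TYPE('d) \<kappa>"

fun chebyshev_U :: "nat \<Rightarrow> real \<Rightarrow> real" where
  "chebyshev_U 0 x = 1"
| "chebyshev_U (Suc 0) x = 2 * x"
| "chebyshev_U (Suc (Suc n)) x = 2 * x * chebyshev_U (Suc n) x - chebyshev_U n x"

lemma chebyshev_U_cos: "chebyshev_U n (cos t) * sin t = sin (real (Suc n) * t)"
proof (induction n "cos t" rule: chebyshev_U.induct)
  case 1
  show ?case by simp
next
  case 2
  show ?case using sin_double[of t] by (simp add: algebra_simps)
next
  case (3 n)
  have "sin (real (Suc (Suc (Suc n))) * t) + sin (real (Suc n) * t)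
      = 2 * cos t * sin (real (Suc (Suc n)) * t)"
    using sin_add[of "real (Suc (Suc n)) * t" t] sin_diff[of "real (Suc (Suc n)) * t" t]
    by (simp add: algebra_simps)
  with 3 show ?case by (simp add: algebra_simps)
qed

definition g :: "nat \<Rightarrow> real ^ ('d::finite) \<Rightarrow> real" where
  "g k x = (\<Sum>i\<in>UNIV. (\<Prod>l\<in>UNIV - {i}. x $ l) * (1 - (x $ i)\<^sup>2) * chebyshev_U (k - 1) (x $ i))"

definition energy_surface :: "real \<Rightarrow> (real ^ ('d::finite)) set" where
  "energy_surface E = {x. (\<forall>i. x $ i \<in> {-1..1}) \<and> (\<Prod>i\<in>UNIV. x $ i) = E}"

text \<open>For \<open>m = 0\<close> the sum is empty and the condition reads \<open>g (j * \<kappa>) (x 0) = 0\<close> for all \<open>j \<ge> 1\<close>.\<close>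

definition Theta_m :: "('d::finite) itself \<Rightarrow> nat \<Rightarrow> nat \<Rightarrow> real set" where
  "Theta_m TYPE('d) m \<kappa> = {E \<in> {-1..1}.
     \<exists>(x :: nat \<Rightarrow> real ^ 'd) (\<omega> :: nat \<Rightarrow> real).
       (\<forall>q\<le>m. x q \<in> energy_surface E) \<and> (\<forall>q<m. \<omega> q \<le> 0) \<and>
       (\<forall>j\<ge>1. g (j * \<kappa>) (x m) = (\<Sum>q<m. \<omega> q * g (j * \<kappa>) (x q)))}"

end

theory Submission
  imports Defs
begin

text \<open>
  The theorem combines an operator-theoretic fact with an elementary construction.

  \<^bold>\<open>Relations give thresholds.\<close> Suppose that a Mourre estimate with constant \<open>\<gamma> > 0\<close> holds near \<open>E\<close> for
  the combination of the \<open>A_sum (j * \<kappa>)\<close> with coefficients \<open>\<rho> j\<close>. A plane wave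
  \<open>n \<mapsto> exp (\<i> * (t \<bullet> n))\<close> cut off to a large box is an approximate joint eigenvector of all shifts
  (\<open>plane_wave_approx\<close>). If the point with coordinates \<open>cos (t i)\<close> is a point \<open>x\<close> of the energy surface,
  the wave is an approximate eigenvector of \<open>MV\<close> at \<open>E\<close> and of the commutator at
  \<open>G x = (\<Sum>j. \<rho> j * g (j * \<kappa>) x)\<close> (\<open>mourre_commutator_approx\<close>). The spectral projection of an open
  interval around \<open>E\<close> hardly changes it, so the estimate gives \<open>\<gamma> \<le> G x\<close> (\<open>mourre_constant_le\<close>).
  The series converges absolutely because \<open>A\<close> is defined on finitely supported sequences
  (\<open>conj_comb_summable\<close>), hence a relation \<open>g (j * \<kappa>) (x m) = (\<Sum>q<m. \<omega> q * g (j * \<kappa>) (x q))\<close> passes to \<open>G\<close>.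
  With \<open>\<omega> q \<le> 0\<close> its left side is positive and its right side is not. So each \<open>Theta_m\<close> consists
  of thresholds (\<open>Theta_m_subset_Theta\<close>).

  \<^bold>\<open>Chains of reflected angles.\<close> In terms of angles, \<open>g k\<close> at the point \<open>(cos a, cos b)\<close> is
  \<open>cos b * sin a * sin (k * a) + cos a * sin b * sin (k * b)\<close>. Let \<open>h = 2 * pi / \<kappa>\<close>. The reflection
  \<open>a \<mapsto> h - a\<close> flips the sign of \<open>sin (j * \<kappa> * a)\<close> for all \<open>j\<close> simultaneously. Start from the angle \<open>0\<close>,
  whose sine vanishes, and let each angle determine the next one by the condition that the
  reflection of the former and the latter give a point of the energy surface. At this point \<open>g\<close> is a
  difference, with positive weights, of the sines at the new and at the old angle; hence every
  sine of the chain is a nonnegative combination of values of \<open>g\<close> (\<open>sine_in_chain_cone\<close>). A relation as above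
  arises when the last value of \<open>g\<close> is a nonpositive multiple of the old sine alone
  (\<open>chain_closes\<close>). This happens if the new angle is \<open>h / 2\<close>, or if it is the reflection of the
  old one.

  For \<open>0 < E < cos h\<close> the angles of the chain increase, and at \<open>E = cos h\<close> they are all \<open>0\<close>. By the
  intermediate value theorem the two ways of closing a chain occur alternately at larger and
  larger energies, beginning with \<open>cos (h / 2) * cos h\<close>, whose first angle is already \<open>h / 2\<close>
  (\<open>energies_exist\<close>). A chain of \<open>n + 1\<close> points forces \<open>cos h - E \<le> 1 / (n + 1)\<close>
  (\<open>energy_gap_le\<close>), so these energies tend to \<open>cos h\<close>.
\<close>

section \<open>Square-summable sequences\<close>

text \<open>Suprema of finite partial sums give summability and the norm bound at once, so the triangle
  inequality and its consequences reduce to \<open>L2_set\<close> over finite sets.\<close>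

lemma l2_intro:
  fixes u :: "('d::finite) seq"
  assumes "\<And>F. finite F \<Longrightarrow> L2_set (\<lambda>n. cmod (u n)) F \<le> M"
  shows "u \<in> l2" and "l2_norm u \<le> M"
proof -
  have M: "0 \<le> M" using assms[of "{}"] by simp
  have le: "(\<Sum>n\<in>F. (cmod (u n))\<^sup>2) \<le> M\<^sup>2" if "finite F" for F
    using assms[OF that] unfolding L2_set_def
    by (metis real_sqrt_le_iff real_sqrt_pow2_iff M real_sqrt_abs abs_of_nonneg)
  have summ: "(\<lambda>n. (cmod (u n))\<^sup>2) summable_on UNIV"
    by (rule nonneg_bdd_above_summable_on) (auto intro!: bdd_aboveI[of _ "M\<^sup>2"] le)
  then show "u \<in> l2" by (simp add: l2_def)
  have "(\<Sum>\<^sub>\<infinity>n. (cmod (u n))\<^sup>2) \<le> M\<^sup>2"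
    by (rule infsum_le_finite_sums[OF summ]) (simp add: le)
  then show "l2_norm u \<le> M"
    unfolding l2_norm_def using M real_le_lsqrt by blast
qed

lemma L2_set_le_l2_norm:
  fixes u :: "('d::finite) seq"
  assumes "u \<in> l2" and "finite F"
  shows "L2_set (\<lambda>n. cmod (u n)) F \<le> l2_norm u"
  unfolding L2_set_def l2_norm_def
  using assms by (intro real_sqrt_le_mono finite_sum_le_infsum) (auto simp: l2_def)

lemma l2_norm_ge_0 [simp]: "0 \<le> l2_norm u"
  unfolding l2_norm_def by (simp add: infsum_nonneg)

lemma cmod_le_l2_norm: "u \<in> l2 \<Longrightarrow> cmod (u n) \<le> l2_norm u"
  using L2_set_le_l2_norm[of u "{n}"] by simp

lemma l2_norm_scale: "l2_norm (\<lambda>n. c * u n) = cmod c * l2_norm u"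
  unfolding l2_norm_def
  by (simp add: norm_mult power_mult_distrib infsum_cmult_right' real_sqrt_mult)

lemma l2_scale [intro]: "u \<in> l2 \<Longrightarrow> (\<lambda>n. c * u n) \<in> l2"
  unfolding l2_def by (auto simp: norm_mult power_mult_distrib intro: summable_on_cmult_right)

lemma l2_add [intro]: "u \<in> l2 \<Longrightarrow> v \<in> l2 \<Longrightarrow> (\<lambda>n. u n + v n) \<in> l2"
  and l2_norm_triangle: "u \<in> l2 \<Longrightarrow> v \<in> l2 \<Longrightarrow> l2_norm (\<lambda>n. u n + v n) \<le> l2_norm u + l2_norm v"
proof -
  have "L2_set (\<lambda>n. cmod (u n + v n)) F \<le> l2_norm u + l2_norm v"
    if "u \<in> l2" "v \<in> l2" "finite F" for F
  proof -
    have "L2_set (\<lambda>n. cmod (u n + v n)) F \<le> L2_set (\<lambda>n. cmod (u n) + cmod (v n)) F"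
      by (intro L2_set_mono) (auto intro: norm_triangle_ineq)
    also have "\<dots> \<le> L2_set (\<lambda>n. cmod (u n)) F + L2_set (\<lambda>n. cmod (v n)) F"
      by (rule L2_set_triangle_ineq)
    finally show ?thesis
      using L2_set_le_l2_norm[OF that(1,3)] L2_set_le_l2_norm[OF that(2,3)] by linarith
  qed
  from l2_intro[OF this]
  show "u \<in> l2 \<Longrightarrow> v \<in> l2 \<Longrightarrow> (\<lambda>n. u n + v n) \<in> l2"
    and "u \<in> l2 \<Longrightarrow> v \<in> l2 \<Longrightarrow> l2_norm (\<lambda>n. u n + v n) \<le> l2_norm u + l2_norm v" by auto
qed

lemma l2_diff [intro]: "u \<in> l2 \<Longrightarrow> v \<in> l2 \<Longrightarrow> (\<lambda>n. u n - v n) \<in> l2"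
  using l2_add[OF _ l2_scale[of v "-1"]] by simp

lemma l2_norm_diff_le:
  assumes "u \<in> l2" and "v \<in> l2"
  shows "l2_norm (\<lambda>n. u n - v n) \<le> l2_norm u + l2_norm v"
  using l2_norm_triangle[OF assms(1) l2_scale[OF assms(2), of "-1"]] l2_norm_scale[of "-1" v]
  by simp

lemma l2_norm_le_diff:
  assumes "u \<in> l2" and "v \<in> l2"
  shows "l2_norm u \<le> l2_norm v + l2_norm (\<lambda>n. u n - v n)"
  using l2_norm_triangle[OF assms(2) l2_diff[OF assms]] by simp

lemma fin_supp_l2: "u \<in> fin_supp \<Longrightarrow> u \<in> l2"
proof -
  assume "u \<in> fin_supp"
  then have "finite {n. u n \<noteq> 0}" by (simp add: fin_supp_def)
  then have "(\<lambda>n. (cmod (u n))\<^sup>2) summable_on UNIV"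
    by (intro summable_on_cong_neutral[THEN iffD1, OF _ _ _ summable_on_finite]) auto
  then show ?thesis by (simp add: l2_def)
qed

lemma l2_sum:
  assumes "finite J" and "\<And>j. j \<in> J \<Longrightarrow> u j \<in> l2"
  shows "(\<lambda>n. \<Sum>j\<in>J. u j n) \<in> l2"
    and "l2_norm (\<lambda>n. \<Sum>j\<in>J. u j n) \<le> (\<Sum>j\<in>J. l2_norm (u j))"
proof -
  have "(\<lambda>n. \<Sum>j\<in>J. u j n) \<in> l2 \<and> l2_norm (\<lambda>n. \<Sum>j\<in>J. u j n) \<le> (\<Sum>j\<in>J. l2_norm (u j))"
    using assms
  proof (induction J)
    case empty
    then show ?case by (simp add: l2_def l2_norm_def)
  next
    case (insert j J)
    then show ?case
      using l2_norm_triangle[of "u j" "\<lambda>n. \<Sum>j\<in>J. u j n"] by auto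
  qed
  then show "(\<lambda>n. \<Sum>j\<in>J. u j n) \<in> l2"
    and "l2_norm (\<lambda>n. \<Sum>j\<in>J. u j n) \<le> (\<Sum>j\<in>J. l2_norm (u j))" by auto
qed

lemma l2_lim_pointwise:
  assumes "l2_lim us u" and "\<And>k. us k \<in> l2" and "u \<in> l2"
  shows "(\<lambda>k. us k n) \<longlonglongrightarrow> u n"
proof -
  have "norm (us k n - u n) \<le> l2_norm (\<lambda>n. us k n - u n)" for k
    using cmod_le_l2_norm[OF l2_diff[OF assms(2)[of k] assms(3)], of n] by simp
  then have "(\<lambda>k. us k n - u n) \<longlonglongrightarrow> 0"
    by (rule Lim_null_comparison[OF always_eventually[OF allI] assms(1)[unfolded l2_lim_def]])
  then show ?thesis by (simp add: LIM_zero_iff)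
qed

text \<open>The lower semicontinuity of the norm: it turns a pointwise identity for an infinite
  combination of operators into a norm bound.\<close>

lemma l2_norm_le_pointwise_limit:
  assumes lim: "\<And>n. (\<lambda>k. us k n) \<longlonglongrightarrow> u n"
    and "\<And>k. us k \<in> l2" and "\<And>k. l2_norm (us k) \<le> M"
  shows "l2_norm u \<le> M"
proof (rule l2_intro(2))
  fix F :: "(int ^ 'a) set" assume "finite F"
  have "(\<lambda>k. L2_set (\<lambda>n. cmod (us k n)) F) \<longlonglongrightarrow> L2_set (\<lambda>n. cmod (u n)) F"
    unfolding L2_set_def by (intro tendsto_intros lim)
  moreover have "L2_set (\<lambda>n. cmod (us k n)) F \<le> M" for k
    using L2_set_le_l2_norm[OF assms(2) \<open>finite F\<close>, of k] assms(3)[of k] by linarith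
  ultimately show "L2_set (\<lambda>n. cmod (u n)) F \<le> M"
    by (intro LIMSEQ_le_const2) auto
qed

subsection \<open>The inner product\<close>

lemma l2_inner_abs_summable:
  fixes u v :: "('d::finite) seq"
  assumes "u \<in> l2" and "v \<in> l2"
  shows "(\<lambda>n. cmod (cnj (u n) * v n)) summable_on UNIV"
    and "(\<Sum>\<^sub>\<infinity>n. cmod (cnj (u n) * v n)) \<le> l2_norm u * l2_norm v"
proof -
  have le: "(\<Sum>n\<in>F. cmod (cnj (u n) * v n)) \<le> l2_norm u * l2_norm v" if "finite F" for F
  proof -
    have "(\<Sum>n\<in>F. cmod (cnj (u n) * v n)) = (\<Sum>n\<in>F. \<bar>cmod (u n)\<bar> * \<bar>cmod (v n)\<bar>)"
      by (simp add: norm_mult)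
    also have "\<dots> \<le> L2_set (\<lambda>n. cmod (u n)) F * L2_set (\<lambda>n. cmod (v n)) F"
      by (rule L2_set_mult_ineq)
    also have "\<dots> \<le> l2_norm u * l2_norm v"
      using assms that by (intro mult_mono L2_set_le_l2_norm) auto
    finally show ?thesis .
  qed
  show s: "(\<lambda>n. cmod (cnj (u n) * v n)) summable_on UNIV"
    by (rule nonneg_bdd_above_summable_on)
      (auto intro!: bdd_aboveI[of _ "l2_norm u * l2_norm v"] le)
  show "(\<Sum>\<^sub>\<infinity>n. cmod (cnj (u n) * v n)) \<le> l2_norm u * l2_norm v"
    by (rule infsum_le_finite_sums[OF s]) (rule le)
qed

lemma l2_inner_summable:
  "u \<in> l2 \<Longrightarrow> v \<in> l2 \<Longrightarrow> (\<lambda>n. cnj (u n) * v n) summable_on UNIV"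
  by (rule abs_summable_summable[OF l2_inner_abs_summable(1)])

lemma l2_Cauchy_Schwarz: "u \<in> l2 \<Longrightarrow> v \<in> l2 \<Longrightarrow> cmod (l2_inner u v) \<le> l2_norm u * l2_norm v"
  unfolding l2_inner_def
  by (rule order_trans[OF norm_infsum_bound[OF l2_inner_abs_summable(1)] l2_inner_abs_summable(2)])

lemma l2_inner_add_right:
  "u \<in> l2 \<Longrightarrow> v \<in> l2 \<Longrightarrow> w \<in> l2 \<Longrightarrow> l2_inner u (\<lambda>n. v n + w n) = l2_inner u v + l2_inner u w"
  unfolding l2_inner_def
  by (simp add: distrib_left infsum_add l2_inner_summable)

lemma l2_inner_scale_right: "l2_inner u (\<lambda>n. c * v n) = c * l2_inner u v"
  unfolding l2_inner_def
  by (simp add: infsum_cmult_right' mult.left_commute)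

lemma l2_inner_commute: "l2_inner v u = cnj (l2_inner u v)"
  unfolding l2_inner_def infsum_cnj[symmetric] by (simp add: mult.commute)

lemma l2_inner_diff_right:
  "u \<in> l2 \<Longrightarrow> v \<in> l2 \<Longrightarrow> w \<in> l2 \<Longrightarrow> l2_inner u (\<lambda>n. v n - w n) = l2_inner u v - l2_inner u w"
  using l2_inner_add_right[of u v "\<lambda>n. -1 * w n"] l2_inner_scale_right[of u "-1" w] l2_scale[of w "-1"]
  by simp

lemma l2_inner_add_left:
  "u \<in> l2 \<Longrightarrow> v \<in> l2 \<Longrightarrow> w \<in> l2 \<Longrightarrow> l2_inner (\<lambda>n. u n + v n) w = l2_inner u w + l2_inner v w"
  by (simp add: l2_inner_commute[of _ w] l2_inner_add_right)

lemma l2_inner_diff_left: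
  "u \<in> l2 \<Longrightarrow> v \<in> l2 \<Longrightarrow> w \<in> l2 \<Longrightarrow> l2_inner (\<lambda>n. u n - v n) w = l2_inner u w - l2_inner v w"
  by (simp add: l2_inner_commute[of _ w] l2_inner_diff_right)

lemma l2_inner_self: "l2_inner u u = of_real ((l2_norm u)\<^sup>2)"
proof -
  have "l2_inner u u = (\<Sum>\<^sub>\<infinity>n. of_real ((cmod (u n))\<^sup>2))"
    unfolding l2_inner_def by (intro infsum_cong) (simp only: complex_norm_square mult.commute)
  also have "\<dots> = of_real (\<Sum>\<^sub>\<infinity>n. (cmod (u n))\<^sup>2)"
    by (rule infsum_bounded_linear_strong[OF summable_on_bounded_linear_iff[OF
          bounded_linear_of_real bounded_linear_Re Re_complex_of_real] bounded_linear_of_real])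
  finally show ?thesis
    by (simp add: l2_norm_def infsum_nonneg)
qed

lemma l2_inner_tendsto:
  assumes "l2_lim us v" and "\<And>k. us k \<in> l2" and "v \<in> l2" and "u \<in> l2"
  shows "(\<lambda>k. l2_inner u (us k)) \<longlonglongrightarrow> l2_inner u v"
proof -
  have "norm (l2_inner u (us k) - l2_inner u v) \<le> l2_norm u * l2_norm (\<lambda>n. us k n - v n)" for k
    using l2_Cauchy_Schwarz[OF assms(4) l2_diff[OF assms(2)[of k] assms(3)]]
    by (simp add: l2_inner_diff_right[OF assms(4) assms(2) assms(3)])
  moreover have "(\<lambda>k. l2_norm u * l2_norm (\<lambda>n. us k n - v n)) \<longlonglongrightarrow> 0"
    using assms(1) unfolding l2_lim_def by (rule tendsto_mult_right_zero)
  ultimately have "(\<lambda>k. l2_inner u (us k) - l2_inner u v) \<longlonglongrightarrow> 0"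
    by (rule Lim_null_comparison[OF always_eventually[OF allI]])
  then show ?thesis by (simp add: LIM_zero_iff)
qed

lemma l2_inner_sum_right:
  assumes "finite J" and "\<And>j. j \<in> J \<Longrightarrow> v j \<in> l2" and "u \<in> l2"
  shows "l2_inner u (\<lambda>n. \<Sum>j\<in>J. v j n) = (\<Sum>j\<in>J. l2_inner u (v j))"
  using assms
proof (induction J)
  case empty
  then show ?case by (simp add: l2_inner_def)
next
  case (insert j J)
  then show ?case by (simp add: l2_inner_add_right l2_sum(1))
qed

section \<open>Spectral projections and approximate eigenvectors\<close>

lemma bounded_op_l2: "bounded_op T \<Longrightarrow> u \<in> l2 \<Longrightarrow> T u \<in> l2"
  and bounded_op_add:
    "bounded_op T \<Longrightarrow> u \<in> l2 \<Longrightarrow> v \<in> l2 \<Longrightarrow> T (\<lambda>n. u n + v n) = (\<lambda>n. T u n + T v n)"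
  and bounded_op_scale: "bounded_op T \<Longrightarrow> u \<in> l2 \<Longrightarrow> T (\<lambda>n. c * u n) = (\<lambda>n. c * T u n)"
  unfolding bounded_op_def by blast+

lemma bounded_op_diff:
  assumes "bounded_op T" and "u \<in> l2" and "v \<in> l2"
  shows "T (\<lambda>n. u n - v n) = (\<lambda>n. T u n - T v n)"
  using bounded_op_add[OF assms(1,2) l2_scale[OF assms(3)], of "-1"]
    bounded_op_scale[OF assms(1,3), of "-1"] by simp

lemma bounded_op_bound:
  assumes "bounded_op T"
  obtains C where "0 \<le> C" and "\<And>u. u \<in> l2 \<Longrightarrow> l2_norm (T u) \<le> C * l2_norm u"
proof -
  from assms obtain C where C: "\<And>u. u \<in> l2 \<Longrightarrow> l2_norm (T u) \<le> C * l2_norm u"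
    unfolding bounded_op_def by blast
  have "l2_norm (T u) \<le> \<bar>C\<bar> * l2_norm u" if "u \<in> l2" for u
    using C[OF that] mult_right_mono[OF abs_ge_self[of C] l2_norm_ge_0[of u]] by linarith
  then show thesis using that[of "\<bar>C\<bar>"] by simp
qed

text \<open>For an everywhere defined bounded operator this is self-adjointness.\<close>

definition symmetric_op :: "('d::finite) op \<Rightarrow> bool" where
  "symmetric_op T \<longleftrightarrow> (\<forall>u\<in>l2. \<forall>v\<in>l2. l2_inner u (T v) = l2_inner (T u) v)"

context
  fixes T :: "('d::finite) op" and P :: "real set \<Rightarrow> 'd op"
  assumes spectral: "spectral_measure T P"
begin

lemma projection_bounded: "X \<in> sets borel \<Longrightarrow> bounded_op (P X)"
  using spectral unfolding spectral_measure_def by blast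

lemma projection_l2 [intro]: "X \<in> sets borel \<Longrightarrow> u \<in> l2 \<Longrightarrow> P X u \<in> l2"
  using projection_bounded bounded_op_l2 by blast

lemma projection_symmetric:
  "X \<in> sets borel \<Longrightarrow> u \<in> l2 \<Longrightarrow> v \<in> l2 \<Longrightarrow> l2_inner u (P X v) = l2_inner (P X u) v"
  by (rule spectral[unfolded spectral_measure_def, THEN conjunct1, rule_format, THEN conjunct2, rule_format])

lemma projection_Int:
  "X \<in> sets borel \<Longrightarrow> Y \<in> sets borel \<Longrightarrow> u \<in> l2 \<Longrightarrow> P X (P Y u) = P (X \<inter> Y) u"
  by (rule spectral[unfolded spectral_measure_def, THEN conjunct2, THEN conjunct1, rule_format])

lemma projection_UNIV: "u \<in> l2 \<Longrightarrow> P UNIV u = u"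
  by (rule spectral[unfolded spectral_measure_def, THEN conjunct2, THEN conjunct2, THEN conjunct1, rule_format])

lemma projection_sigma_additive:
  fixes X :: "nat \<Rightarrow> real set"
  assumes "range X \<subseteq> sets borel" and "disjoint_family X" and "u \<in> l2"
  shows "l2_lim (\<lambda>k n. \<Sum>i<k. P (X i) u n) (P (\<Union>i. X i) u)"
  by (rule spectral[unfolded spectral_measure_def, THEN conjunct2, THEN conjunct2, THEN conjunct2, THEN conjunct1, rule_format]) (fact assms)+

lemma projection_sums_pointwise:
  fixes X :: "nat \<Rightarrow> real set"
  assumes X: "range X \<subseteq> sets borel" "disjoint_family X" and u: "u \<in> l2"
  shows "(\<lambda>i. P (X i) u n) sums P (\<Union>i. X i) u n"
proof -
  have "X i \<in> sets borel" for i using X by blast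
  then have "(\<lambda>k. \<Sum>i<k. P (X i) u n) \<longlonglongrightarrow> P (\<Union>i. X i) u n"
    using u by (intro l2_lim_pointwise[OF projection_sigma_additive[OF X u]] l2_sum(1)) auto
  then show ?thesis by (simp add: sums_def)
qed

text \<open>A constant series converges only if its terms vanish, so \<open>P {} = 0\<close> is a consequence of
  countable additivity.\<close>

lemma projection_empty:
  assumes "u \<in> l2"
  shows "P {} u = (\<lambda>n. 0)"
proof
  fix n
  have "(\<lambda>i::nat. P {} u n) sums P {} u n"
    using projection_sums_pointwise[of "\<lambda>_. {}" u n] assms by (simp add: disjoint_family_on_def)
  then show "P {} u n = 0"
    using sums_summable summable_const_iff by blast
qed

lemma projection_Un:
  assumes "X \<in> sets borel" and "Y \<in> sets borel" and "X \<inter> Y = {}" and "u \<in> l2"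
  shows "P (X \<union> Y) u = (\<lambda>n. P X u n + P Y u n)"
proof
  fix n
  have r: "range (binaryset X Y) \<subseteq> sets borel"
    using assms by (auto simp: range_binaryset_eq)
  have d: "disjoint_family (binaryset X Y)"
    using assms(3) by (auto simp: disjoint_family_on_def binaryset_def)
  have "(\<lambda>i. P (binaryset X Y i) u n) sums P (X \<union> Y) u n"
    using projection_sums_pointwise[OF r d assms(4), of n] by (simp add: UN_binaryset_eq)
  moreover have "(\<lambda>i. P (binaryset X Y i) u n) sums (\<Sum>i\<in>{0,1}. P (binaryset X Y i) u n)"
    by (rule sums_finite) (auto simp: binaryset_def projection_empty[OF assms(4)])
  ultimately show "P (X \<union> Y) u n = P X u n + P Y u n"
    using sums_unique2 by (fastforce simp: binaryset_def)
qed

lemma projection_form: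
  assumes "X \<in> sets borel" and "u \<in> l2"
  shows "l2_inner u (P X u) = of_real ((l2_norm (P X u))\<^sup>2)"
  using projection_symmetric[OF assms(1,2) projection_l2[OF assms]] projection_Int[OF assms(1,1,2)]
  by (simp add: l2_inner_self)

lemma projection_orthogonal:
  assumes "X \<in> sets borel" and "Y \<in> sets borel" and "X \<inter> Y = {}" and "u \<in> l2" and "v \<in> l2"
  shows "l2_inner (P X u) (P Y v) = 0"
proof -
  have "l2_inner (P X u) (P Y v) = l2_inner u (P X (P Y v))"
    using assms by (simp add: projection_symmetric projection_l2)
  also have "\<dots> = 0"
    using assms by (simp add: projection_Int projection_empty l2_inner_def)
  finally show ?thesis .
qed

text \<open>A measure built by \<open>measure_of\<close> has the prescribed values only if the set function is countably
  additive. Here this is strong convergence tested against \<open>u\<close>.\<close>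

lemma emeasure_scalar_measure:
  assumes "u \<in> l2" and "X \<in> sets borel"
  shows "emeasure (scalar_measure P u) X = ennreal (Re (l2_inner u (P X u)))"
  unfolding scalar_measure_def
proof (rule emeasure_measure_of_sigma[OF _ _ _ assms(2)])
  show "sigma_algebra UNIV (sets (borel :: real measure))"
    using sets.sigma_algebra_axioms[of "borel :: real measure"] by simp
  show "positive (sets borel) (\<lambda>X. ennreal (Re (l2_inner u (P X u))))"
    by (simp add: positive_def projection_empty[OF assms(1)] l2_inner_def)
  show "countably_additive (sets borel) (\<lambda>X. ennreal (Re (l2_inner u (P X u))))"
  proof (rule countably_additiveI)
    fix X :: "nat \<Rightarrow> real set"
    assume X: "range X \<subseteq> sets borel" "disjoint_family X"
    then have Xi: "X i \<in> sets borel" for i by blast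
    then have XU: "(\<Union>i. X i) \<in> sets borel" by blast
    have "(\<lambda>k. l2_inner u (\<lambda>n. \<Sum>i<k. P (X i) u n)) \<longlonglongrightarrow> l2_inner u (P (\<Union>i. X i) u)"
      using assms(1) Xi XU
      by (intro l2_inner_tendsto[OF projection_sigma_additive[OF X assms(1)]] l2_sum(1)) auto
    then have "(\<lambda>i. l2_inner u (P (X i) u)) sums l2_inner u (P (\<Union>i. X i) u)"
      using assms(1) Xi by (simp add: sums_def l2_inner_sum_right projection_l2)
    then show "(\<Sum>i. ennreal (Re (l2_inner u (P (X i) u)))) = ennreal (Re (l2_inner u (P (\<Union>i. X i) u)))"
      using assms(1) Xi
      by (intro suminf_ennreal_eq sums_Re) (auto simp: projection_form)
  qed
qed

lemma sets_scalar_measure [simp]: "sets (scalar_measure P u) = sets borel"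
  and space_scalar_measure [simp]: "space (scalar_measure P u) = UNIV"
proof -
  show "sets (scalar_measure P u) = sets borel"
    unfolding scalar_measure_def
    using sets.sigma_sets_eq[of "borel :: real measure"] by (simp add: sets_measure_of)
  show "space (scalar_measure P u) = UNIV"
    unfolding scalar_measure_def by (simp add: space_measure_of)
qed

lemma form_eq_integral:
  assumes "u \<in> l2"
  shows "integrable (scalar_measure P u) (\<lambda>t. t)"
    and "l2_inner u (T u) = of_real (\<integral>t. t \<partial>scalar_measure P u)"
  using spectral[unfolded spectral_measure_def, THEN conjunct2, THEN conjunct2, THEN conjunct2, THEN conjunct2, rule_format, OF assms] by simp_all

text \<open>The vectors \<open>v + r\<close> and \<open>v - r\<close> have the same scalar measure because the ranges of the two
  projections are orthogonal, hence \<open>T\<close> has the same expectation in both. The difference of the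
  two expectations is four times the real part of the off-diagonal term.\<close>

lemma form_orthogonal:
  assumes T: "bounded_op T" "symmetric_op T" and Y: "Y \<in> sets borel" and u: "u \<in> l2"
  shows "Re (l2_inner (P Y u) (T (P (- Y) u))) = 0"
proof -
  define v r where "v = P Y u" and "r = P (- Y) u"
  have Y': "- Y \<in> sets borel" using Y by simp
  have vr [simp]: "v \<in> l2" "r \<in> l2" unfolding v_def r_def using Y Y' u by auto
  have zero: "l2_inner v (P Z r) = 0" "l2_inner r (P Z v) = 0" if Z: "Z \<in> sets borel" for Z
    unfolding v_def r_def projection_Int[OF Z Y u] projection_Int[OF Z Y' u]
    using Z Y Y' u by (auto intro!: projection_orthogonal)
  have "l2_inner (\<lambda>n. v n + r n) (P Z (\<lambda>n. v n + r n))
      = l2_inner (\<lambda>n. v n - r n) (P Z (\<lambda>n. v n - r n))" if Z: "Z \<in> sets borel" for Z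
  proof -
    note b = projection_bounded[OF Z]
    have [simp]: "P Z v \<in> l2" "P Z r \<in> l2" using Z by auto
    have "l2_inner (\<lambda>n. v n + r n) (P Z (\<lambda>n. v n + r n)) = l2_inner v (P Z v) + l2_inner r (P Z r)"
      by (simp add: bounded_op_add[OF b] l2_inner_add_left l2_inner_add_right l2_add zero[OF Z])
    moreover have "l2_inner (\<lambda>n. v n - r n) (P Z (\<lambda>n. v n - r n)) = l2_inner v (P Z v) + l2_inner r (P Z r)"
      by (simp add: bounded_op_diff[OF b] l2_inner_diff_left l2_inner_diff_right l2_diff zero[OF Z])
    ultimately show ?thesis by simp
  qed
  then have "scalar_measure P (\<lambda>n. v n + r n) = scalar_measure P (\<lambda>n. v n - r n)"
    unfolding scalar_measure_def
    by (intro measure_of_eq) (auto simp: sets.sigma_sets_eq[of "borel :: real measure", simplified])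
  then have "l2_inner (\<lambda>n. v n + r n) (T (\<lambda>n. v n + r n)) = l2_inner (\<lambda>n. v n - r n) (T (\<lambda>n. v n - r n))"
    by (simp add: form_eq_integral l2_add l2_diff)
  then have "2 * (l2_inner v (T r) + l2_inner r (T v)) = 0"
    using T(1) by (simp add: bounded_op_add bounded_op_diff l2_inner_add_left l2_inner_add_right
        l2_inner_diff_left l2_inner_diff_right l2_add l2_diff bounded_op_l2 add.commute)
  then have "l2_inner v (T r) + l2_inner r (T v) = 0" by (simp only: mult_eq_0_iff) simp
  moreover have "l2_inner r (T v) = cnj (l2_inner v (T r))"
    using T(2) vr unfolding symmetric_op_def by (metis l2_inner_commute)
  ultimately show ?thesis unfolding v_def r_def by (auto simp: complex_eq_iff)
qed

text \<open>The scalar measure of \<open>P Y u\<close> lives on \<open>Y\<close>. The factor \<open>s\<close> will be \<open>1\<close> for a set \<open>Y\<close> above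
  the energy and \<open>-1\<close> for one below it.\<close>

lemma form_lower_bound:
  assumes Y: "Y \<in> sets borel" and u: "u \<in> l2" and d: "\<And>t. t \<in> Y \<Longrightarrow> d \<le> s * (t - E)"
  shows "d * (l2_norm (P Y u))\<^sup>2
    \<le> s * (Re (l2_inner (P Y u) (T (P Y u))) - E * (l2_norm (P Y u))\<^sup>2)"
proof -
  define v where "v = P Y u"
  define M where "M = scalar_measure P v"
  have v: "v \<in> l2" unfolding v_def using Y u by auto
  have M [simp]: "sets M = sets borel" "space M = UNIV" unfolding M_def by simp_all
  have em: "emeasure M UNIV = ennreal ((l2_norm v)\<^sup>2)"
    unfolding M_def using v by (simp add: emeasure_scalar_measure projection_UNIV l2_inner_self)
  interpret finite_measure M
    by standard (simp add: em)
  have meas: "measure M UNIV = (l2_norm v)\<^sup>2" by (simp add: measure_def em)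
  have "emeasure M (- Y) = 0"
  proof -
    have "P (- Y) v = (\<lambda>n. 0)"
      unfolding v_def using Y u by (simp add: projection_Int projection_empty)
    then show ?thesis
      unfolding M_def using v Y by (simp add: emeasure_scalar_measure l2_inner_def)
  qed
  then have "AE t in M. t \<in> Y"
    by (intro AE_I[of _ _ "- Y"]) (use Y in auto)
  then have ae: "AE t in M. d \<le> s * (t - E)" by eventually_elim (rule d)
  have int: "integrable M (\<lambda>t. t)" unfolding M_def by (rule form_eq_integral(1)[OF v])
  have "(\<integral>t. d \<partial>M) \<le> (\<integral>t. s * (t - E) \<partial>M)"
    by (intro integral_mono_AE ae integrable_const integrable_mult_right Bochner_Integration.integrable_diff int)
  also have "\<dots> = s * ((\<integral>t. t \<partial>M) - E * (l2_norm v)\<^sup>2)"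
    using int by (simp add: meas)
  also have "(\<integral>t. t \<partial>M) = Re (l2_inner v (T v))"
    unfolding M_def by (simp add: form_eq_integral(2)[OF v])
  finally show ?thesis by (simp add: meas v_def mult.commute)
qed

text \<open>On the range of \<open>P Y\<close> the form of \<open>T - E\<close> is at distance \<open>d\<close> from zero, and by
  \<open>form_orthogonal\<close> only this part of \<open>u\<close> contributes to \<open>Re \<langle>P Y u, (T - E) u\<rangle>\<close>; Cauchy--Schwarz
  does the rest.\<close>

lemma projection_away_from_energy:
  assumes T: "bounded_op T" "symmetric_op T" and Y: "Y \<in> sets borel" and u: "u \<in> l2"
    and d: "\<And>t. t \<in> Y \<Longrightarrow> d \<le> s * (t - E)" and s: "\<bar>s\<bar> = 1"
  shows "d * l2_norm (P Y u) \<le> l2_norm (\<lambda>n. T u n - of_real E * u n)"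
proof -
  define v r where "v = P Y u" and "r = P (- Y) u"
  define x where "x = (\<lambda>n. T u n - of_real E * u n)"
  have Y': "- Y \<in> sets borel" using Y by simp
  have [simp]: "v \<in> l2" "r \<in> l2" unfolding v_def r_def using Y Y' u by auto
  have Tl2 [simp]: "w \<in> l2 \<Longrightarrow> T w \<in> l2" for w by (rule bounded_op_l2[OF T(1)])
  have x: "x \<in> l2" unfolding x_def using u by (simp add: l2_diff l2_scale)
  have uvr: "u = (\<lambda>n. v n + r n)"
    using projection_Un[OF Y Y' _ u] projection_UNIV[OF u] unfolding v_def r_def by (simp add: Compl_partition)
  have "Re (l2_inner v (T u)) = Re (l2_inner v (T v))"
    unfolding uvr bounded_op_add[OF T(1) \<open>v \<in> l2\<close> \<open>r \<in> l2\<close>]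
    using form_orthogonal[OF T Y u] by (simp add: l2_inner_add_right flip: v_def r_def)
  moreover have "Re (l2_inner v u) = (l2_norm v)\<^sup>2"
    using projection_form[OF Y u] projection_symmetric[OF Y u u] by (simp add: v_def)
  ultimately have vx: "Re (l2_inner v x) = Re (l2_inner v (T v)) - E * (l2_norm v)\<^sup>2"
    unfolding x_def using u by (simp add: l2_inner_diff_right l2_inner_scale_right l2_scale)
  have "d * (l2_norm v)\<^sup>2 \<le> s * Re (l2_inner v x)"
    unfolding vx using form_lower_bound[OF Y u d] by (simp add: v_def)
  also have "\<dots> \<le> \<bar>s\<bar> * \<bar>Re (l2_inner v x)\<bar>" by (metis abs_ge_self abs_mult)
  also have "\<dots> \<le> l2_norm v * l2_norm x"
    using s abs_Re_le_cmod[of "l2_inner v x"] l2_Cauchy_Schwarz[OF \<open>v \<in> l2\<close> x] by simp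
  finally have "l2_norm v * (d * l2_norm v) \<le> l2_norm v * l2_norm x"
    by (simp add: power2_eq_square mult_ac)
  then show ?thesis
    unfolding v_def[symmetric] x_def[symmetric]
    using l2_norm_ge_0[of v] l2_norm_ge_0[of x] by (cases "l2_norm v = 0") (auto simp: mult_le_cancel_left)
qed

lemma projection_near_energy:
  assumes T: "bounded_op T" "symmetric_op T" and u: "u \<in> l2" and E: "a < E" "E < b"
  shows "l2_norm (\<lambda>n. u n - P {a<..<b} u n)
    \<le> (1 / (b - E) + 1 / (E - a)) * l2_norm (\<lambda>n. T u n - of_real E * u n)"
proof -
  let ?x = "l2_norm (\<lambda>n. T u n - of_real E * u n)"
  have hi: "(b - E) * l2_norm (P {b..} u) \<le> ?x"
    by (rule projection_away_from_energy[OF T _ u, where s = 1]) auto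
  have lo: "(E - a) * l2_norm (P {..a} u) \<le> ?x"
    by (rule projection_away_from_energy[OF T _ u, where s = "-1"]) auto
  have "u = P (({a<..<b} \<union> {b..}) \<union> {..a}) u"
  proof -
    have "({a<..<b} \<union> {b..}) \<union> {..a} = UNIV" using E by auto
    then show ?thesis using projection_UNIV[OF u] by simp
  qed
  also have "\<dots> = (\<lambda>n. P ({a<..<b} \<union> {b..}) u n + P {..a} u n)"
    by (rule projection_Un) (use E u in auto)
  also have "\<dots> = (\<lambda>n. P {a<..<b} u n + P {b..} u n + P {..a} u n)"
    by (subst projection_Un) (use E u in auto)
  finally have "u n - P {a<..<b} u n = P {b..} u n + P {..a} u n" for n
    by (metis (no_types, lifting) add.assoc add_diff_cancel_left')
  then have "l2_norm (\<lambda>n. u n - P {a<..<b} u n) \<le> l2_norm (P {b..} u) + l2_norm (P {..a} u)"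
    using u by (simp add: l2_norm_triangle projection_l2)
  also have "\<dots> \<le> ?x / (b - E) + ?x / (E - a)"
    using hi lo E by (intro add_mono) (auto simp: pos_le_divide_eq mult.commute)
  finally show ?thesis by (simp add: algebra_simps)
qed

end

text \<open>A Mourre estimate over any open interval around \<open>E\<close> is tested on approximate eigenvectors
  \<open>u\<close> of \<open>T\<close> at \<open>E\<close>: the spectral projection barely changes \<open>u\<close>, and if \<open>u\<close> is also an
  approximate eigenvector of the commutator, the constant is at most that eigenvalue.\<close>

lemma mourre_constant_le:
  fixes T B Q :: "('d::finite) op" and c :: real
  assumes T: "bounded_op T" "symmetric_op T" and B: "bounded_op B"
    and Q: "spectral_proj T {a<..<b} Q" and E: "a < E" "E < b"
    and mourre: "op_le (\<lambda>u n. of_real \<gamma> * Q u n) (Q \<circ> B \<circ> Q)"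
    and approx: "\<And>\<epsilon>. \<epsilon> > 0 \<Longrightarrow> \<exists>u\<in>l2. 0 < l2_norm u \<and>
        l2_norm (\<lambda>n. T u n - of_real E * u n) \<le> \<epsilon> * l2_norm u \<and>
        l2_norm (\<lambda>n. B u n - of_real c * u n) \<le> \<epsilon> * l2_norm u"
  shows "\<gamma> \<le> c"
proof (rule ccontr)
  assume "\<not> \<gamma> \<le> c"
  then have gc: "0 < \<gamma> - c" by simp
  from Q obtain P where P: "spectral_measure T P" "Q = P {a<..<b}"
    unfolding spectral_proj_def by blast
  obtain C where C: "0 \<le> C" "\<And>u. u \<in> l2 \<Longrightarrow> l2_norm (B u) \<le> C * l2_norm u"
    using bounded_op_bound[OF B] by blast
  \<comment> \<open>With an error \<open>\<epsilon>\<close>, the projected vector is off by \<open>K * \<epsilon>\<close> and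
    \<open>B - c\<close> takes it to norm at most \<open>L * \<epsilon>\<close>, relative to the norm of \<open>u\<close>; \<open>\<epsilon>\<close> is small enough to keep half of the norm and to beat \<open>\<gamma> - c\<close>.\<close>
  define K where "K = 1 / (b - E) + 1 / (E - a)"
  have K: "K > 0" unfolding K_def using E by (intro add_pos_pos) auto
  define L where "L = (C + \<bar>c\<bar>) * K + 1"
  have L: "L > 0" unfolding L_def using C K by (simp add: add_nonneg_pos)
  define \<epsilon> where "\<epsilon> = min (1 / (2 * K)) ((\<gamma> - c) / (4 * L))"
  have \<epsilon>: "\<epsilon> > 0" "K * \<epsilon> \<le> 1 / 2" "2 * (L * \<epsilon>) < \<gamma> - c"
  proof -
    show "\<epsilon> > 0" unfolding \<epsilon>_def using gc K L by simp
    have "K * \<epsilon> \<le> K * (1 / (2 * K))" unfolding \<epsilon>_def using K by (intro mult_left_mono) auto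
    then show "K * \<epsilon> \<le> 1 / 2" using K by simp
    have "L * \<epsilon> \<le> L * ((\<gamma> - c) / (4 * L))" unfolding \<epsilon>_def using L by (intro mult_left_mono) auto
    also have "\<dots> = (\<gamma> - c) / 4" using L by simp
    finally show "2 * (L * \<epsilon>) < \<gamma> - c" using gc by simp
  qed
  from approx[OF \<epsilon>(1)] obtain u where u: "u \<in> l2" "0 < l2_norm u"
    and Tu: "l2_norm (\<lambda>n. T u n - of_real E * u n) \<le> \<epsilon> * l2_norm u"
    and Bu: "l2_norm (\<lambda>n. B u n - of_real c * u n) \<le> \<epsilon> * l2_norm u" by blast
  define w where "w = Q u"
  have ab: "{a<..<b} \<in> sets borel" by simp
  have w: "w \<in> l2" unfolding w_def P(2) by (rule projection_l2[OF P(1) ab u(1)])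
  note [simp] = u(1) w bounded_op_l2[OF B] l2_diff l2_scale
  have uw: "l2_norm (\<lambda>n. u n - w n) \<le> K * \<epsilon> * l2_norm u"
  proof -
    have "l2_norm (\<lambda>n. u n - w n) \<le> K * l2_norm (\<lambda>n. T u n - of_real E * u n)"
      unfolding w_def P(2) K_def by (rule projection_near_energy[OF P(1) T u(1) E])
    also have "\<dots> \<le> K * (\<epsilon> * l2_norm u)" using K Tu by (intro mult_left_mono) auto
    finally show ?thesis by (simp add: mult_ac)
  qed
  have wu: "l2_norm u / 2 \<le> l2_norm w"
  proof -
    have "K * \<epsilon> * l2_norm u \<le> 1 / 2 * l2_norm u" using \<epsilon>(2) u(2) by (intro mult_right_mono) auto
    then show ?thesis using uw l2_norm_le_diff[OF u(1) w] by simp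
  qed
  define y where "y = (\<lambda>n. B w n - of_real c * w n)"
  have y: "y \<in> l2" unfolding y_def by simp
  have "l2_norm y \<le> L * \<epsilon> * l2_norm u"
  proof -
    have "y = (\<lambda>n. (B u n - of_real c * u n) - (B (\<lambda>n. u n - w n) n - of_real c * (u n - w n)))"
      unfolding y_def by (simp add: bounded_op_diff[OF B] algebra_simps)
    then have "l2_norm y \<le> l2_norm (\<lambda>n. B u n - of_real c * u n)
        + l2_norm (\<lambda>n. B (\<lambda>n. u n - w n) n - of_real c * (u n - w n))"
      by (simp add: l2_norm_diff_le)
    also have "l2_norm (\<lambda>n. B (\<lambda>n. u n - w n) n - of_real c * (u n - w n))
        \<le> C * l2_norm (\<lambda>n. u n - w n) + \<bar>c\<bar> * l2_norm (\<lambda>n. u n - w n)"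
      using l2_norm_diff_le[of "B (\<lambda>n. u n - w n)" "\<lambda>n. of_real c * (u n - w n)"]
        C(2)[of "\<lambda>n. u n - w n"] l2_norm_scale[of "of_real c" "\<lambda>n. u n - w n"] by simp
    also have "\<dots> = (C + \<bar>c\<bar>) * l2_norm (\<lambda>n. u n - w n)" by (simp add: algebra_simps)
    also have "\<dots> \<le> (C + \<bar>c\<bar>) * (K * \<epsilon> * l2_norm u)" using C uw by (intro mult_left_mono) auto
    finally show ?thesis using Bu unfolding L_def by (simp add: algebra_simps)
  qed
  moreover have "(\<gamma> - c) * l2_norm w \<le> l2_norm y"
  proof -
    have QBw: "Q (B w) \<in> l2" unfolding P(2) by (rule projection_l2[OF P(1) ab]) simp
    have "0 \<le> Re (l2_inner u (\<lambda>n. (Q \<circ> B \<circ> Q) u n - of_real \<gamma> * Q u n))"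
      using mourre u(1) unfolding op_le_def by blast
    also have "l2_inner u (\<lambda>n. (Q \<circ> B \<circ> Q) u n - of_real \<gamma> * Q u n)
        = l2_inner u (Q (B w)) - of_real \<gamma> * l2_inner u w"
      using QBw by (simp add: l2_inner_diff_right l2_inner_scale_right flip: w_def)
    also have "l2_inner u (Q (B w)) = l2_inner w (B w)"
      unfolding w_def P(2)
      by (rule projection_symmetric[OF P(1) ab]) (use w in \<open>simp_all add: w_def P(2)\<close>)
    also have "l2_inner u w = of_real ((l2_norm w)\<^sup>2)"
      unfolding w_def P(2) by (rule projection_form[OF P(1) ab u(1)])
    finally have "\<gamma> * (l2_norm w)\<^sup>2 \<le> Re (l2_inner w (B w))" by simp
    moreover have "Re (l2_inner w y) = Re (l2_inner w (B w)) - c * (l2_norm w)\<^sup>2"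
      unfolding y_def by (simp add: l2_inner_diff_right l2_inner_scale_right l2_inner_self)
    moreover have "Re (l2_inner w y) \<le> l2_norm w * l2_norm y"
      using complex_Re_le_cmod l2_Cauchy_Schwarz[OF w y] order_trans by blast
    ultimately have "l2_norm w * ((\<gamma> - c) * l2_norm w) \<le> l2_norm w * l2_norm y"
      by (simp add: algebra_simps power2_eq_square)
    moreover have "0 < l2_norm w" using wu u(2) by simp
    ultimately show ?thesis by simp
  qed
  moreover have "(\<gamma> - c) * (l2_norm u / 2) \<le> (\<gamma> - c) * l2_norm w"
    using wu gc by (intro mult_left_mono) auto
  ultimately have "(\<gamma> - c) * l2_norm u \<le> 2 * (L * \<epsilon>) * l2_norm u" by simp
  then show False using u(2) \<epsilon>(3) by simp
qed

section \<open>Shifts, the Laplacian and the commutators\<close>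

lemma shift_add: "shift i k (shift i l u) = shift i (k + l) u"
proof -
  have "axis i k + axis i l = axis i (k + l)"
    by (simp add: vec_eq_iff axis_def)
  then show ?thesis
    by (simp add: shift_def fun_eq_iff diff_diff_eq)
qed

lemma shift_0 [simp]: "shift i 0 u = u"
proof -
  have "axis i 0 = (0 :: int ^ 'a)" by (simp add: vec_eq_iff axis_def)
  then show ?thesis unfolding shift_def by (simp only: diff_zero)
qed

lemma bij_minus_const: "bij (\<lambda>n :: int ^ 'd. n - c)"
  by (rule bij_betw_byWitness[of _ "\<lambda>n. n + c"]) auto

lemma l2_norm_shift [simp]: "l2_norm (shift i k u) = l2_norm u"
  unfolding l2_norm_def shift_def
  using infsum_reindex_bij_betw[OF bij_minus_const, of "\<lambda>n. (cmod (u n))\<^sup>2"] by simp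

lemma l2_shift [simp]: "shift i k u \<in> l2 \<longleftrightarrow> u \<in> l2"
  unfolding l2_def shift_def
  using summable_on_reindex_bij_betw[OF bij_minus_const, of "\<lambda>n. (cmod (u n))\<^sup>2"] by simp

lemma l2_inner_shift: "l2_inner u (shift i k v) = l2_inner (shift i (- k) u) v"
proof -
  have "l2_inner (shift i (- k) u) v
      = (\<Sum>\<^sub>\<infinity>n. cnj (shift i (- k) u (n - axis i k)) * v (n - axis i k))"
    unfolding l2_inner_def by (rule infsum_reindex_bij_betw[OF bij_minus_const, symmetric])
  moreover have "shift i (- k) u (n - axis i k) = shift i k (shift i (- k) u) n" for n
    by (simp only: shift_def)
  ultimately show ?thesis
    by (simp only: shift_add add.right_inverse shift_0) (simp only: l2_inner_def shift_def)
qed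

text \<open>The operator \<open>\<i> [Delta i, A_coord i k]\<close>. On a plane wave of angle \<open>t\<close> it is multiplication by
  \<open>(cos ((k - 1) * t) - cos ((k + 1) * t)) / 2 = sin t * sin (k * t)\<close>.\<close>

definition shift_sine :: "'d::finite \<Rightarrow> nat \<Rightarrow> 'd op" where
  "shift_sine i k u = (\<lambda>n. (shift i (int k - 1) u n + shift i (1 - int k) u n
      - shift i (int k + 1) u n - shift i (- int k - 1) u n) / 4)"

lemma l2_divide [intro]: "u \<in> l2 \<Longrightarrow> (\<lambda>n. u n / c) \<in> l2"
  using l2_scale[of u "1 / c"] by simp

lemma l2_norm_divide: "l2_norm (\<lambda>n. u n / c) = l2_norm u / cmod c"
  using l2_norm_scale[of "1 / c" u] by (simp add: norm_divide)

lemma Delta_l2 [simp]: "u \<in> l2 \<Longrightarrow> Delta i u \<in> l2"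
  unfolding Delta_def by (intro l2_divide l2_add) simp_all

lemma Delta_norm_le: "u \<in> l2 \<Longrightarrow> l2_norm (Delta i u) \<le> l2_norm u"
  using l2_norm_triangle[of "shift i 1 u" "shift i (-1) u"]
  by (simp add: Delta_def l2_norm_divide)

lemma Delta_add: "Delta i (\<lambda>n. u n + v n) = (\<lambda>n. Delta i u n + Delta i v n)"
  and Delta_scale: "Delta i (\<lambda>n. c * u n) = (\<lambda>n. c * Delta i u n)"
  by (simp_all add: Delta_def shift_def fun_eq_iff algebra_simps add_divide_distrib)

lemma Delta_commute: "Delta i (Delta j u) = Delta j (Delta i u)"
  by (auto simp: Delta_def shift_def fun_eq_iff algebra_simps add_divide_distrib)

lemma Delta_symmetric: "u \<in> l2 \<Longrightarrow> v \<in> l2 \<Longrightarrow> l2_inner u (Delta i v) = l2_inner (Delta i u) v"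
proof -
  assume uv: "u \<in> l2" "v \<in> l2"
  have D: "Delta i w = (\<lambda>n. (1/2) * (shift i 1 w n + shift i (-1) w n))" for w
    by (simp add: Delta_def)
  have "l2_inner u (Delta i v) = (1/2) * (l2_inner (shift i (-1) u) v + l2_inner (shift i 1 u) v)"
    unfolding D l2_inner_scale_right using uv by (simp add: l2_inner_add_right l2_inner_shift)
  also have "\<dots> = cnj (l2_inner v (Delta i u))"
    unfolding D l2_inner_scale_right
    using uv by (simp add: l2_inner_add_right l2_inner_commute[of _ v] add.commute)
  also have "\<dots> = l2_inner (Delta i u) v" by (rule l2_inner_commute[symmetric])
  finally show ?thesis .
qed

lemma shift_sine_l2 [simp]: "u \<in> l2 \<Longrightarrow> shift_sine i k u \<in> l2"
  unfolding shift_sine_def by (intro l2_divide l2_add l2_diff) simp_all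

lemma shift_sine_norm_le:
  assumes "u \<in> l2" shows "l2_norm (shift_sine i k u) \<le> l2_norm u"
proof -
  let ?a = "shift i (int k - 1) u" and ?b = "shift i (1 - int k) u"
    and ?c = "shift i (int k + 1) u" and ?d = "shift i (- int k - 1) u"
  have "l2_norm (\<lambda>n. ((?a n + ?b n) - ?c n) - ?d n) \<le> l2_norm ?a + l2_norm ?b + l2_norm ?c + l2_norm ?d"
    using assms l2_norm_diff_le[of "\<lambda>n. (?a n + ?b n) - ?c n" ?d]
      l2_norm_diff_le[of "\<lambda>n. ?a n + ?b n" ?c] l2_norm_triangle[of ?a ?b]
    by (simp add: l2_add l2_diff)
  then show ?thesis by (simp add: shift_sine_def l2_norm_divide)
qed

lemma shift_sine_diff: "shift_sine i k (\<lambda>n. u n - v n) = (\<lambda>n. shift_sine i k u n - shift_sine i k v n)"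
  and shift_sine_scale: "shift_sine i k (\<lambda>n. c * u n) = (\<lambda>n. c * shift_sine i k u n)"
  by (simp_all add: shift_sine_def shift_def fun_eq_iff field_simps)

lemma MV_apply: "MV u = Delta (1::2) (Delta 2 u)"
  by (simp add: MV_2)

lemma MV_bounded: "bounded_op (MV :: 2 op)"
  unfolding bounded_op_def MV_apply
proof (intro conjI ballI allI exI[of _ 1])
  fix u :: "2 seq" assume "u \<in> l2"
  then show "l2_norm (Delta 1 (Delta 2 u)) \<le> 1 * l2_norm u"
    using Delta_norm_le[of "Delta 2 u" 1] Delta_norm_le[of u 2] by simp
qed (simp_all add: Delta_add Delta_scale)

lemma MV_symmetric: "symmetric_op (MV :: 2 op)"
  unfolding symmetric_op_def MV_apply by (simp add: Delta_symmetric Delta_commute[of 1 2])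

lemma A_coord_apply:
  "A_coord i k u n = ((2 * of_int (n $ i) - of_nat k) * shift i (int k) u n
    - (2 * of_int (n $ i) + of_nat k) * shift i (- int k) u n) / (4 * \<i>)"
  by (simp add: A_coord_def shift_diff_def position_def shift_def axis_def algebra_simps)

lemma A_coord_Delta_other:
  assumes "i \<noteq> j"
  shows "A_coord i k (Delta j u) = Delta j (A_coord i k u)"
proof
  fix n
  have [simp]: "axis j (c :: int) $ i = 0" for c using assms by (simp add: axis_def)
  have sw: "shift i a (shift j b u) = shift j b (shift i a u)" for a b
    by (simp add: shift_def fun_eq_iff algebra_simps)
  have sD: "shift i a (Delta j u) n = (shift j 1 (shift i a u) n + shift j (-1) (shift i a u) n) / 2" for a
    unfolding Delta_def by (simp add: sw[symmetric]) (simp add: shift_def)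
  have sc: "shift j b (\<lambda>n. ((2 * of_int (n $ i) - of_nat k) * v n - (2 * of_int (n $ i) + of_nat k) * w n) / (4 * \<i>)) n
     = ((2 * of_int (n $ i) - of_nat k) * shift j b v n - (2 * of_int (n $ i) + of_nat k) * shift j b w n) / (4 * \<i>)"
    for b v w by (simp add: shift_def)
  have Ac: "A_coord i k u = (\<lambda>n. ((2 * of_int (n $ i) - of_nat k) * shift i (int k) u n
    - (2 * of_int (n $ i) + of_nat k) * shift i (- int k) u n) / (4 * \<i>))"
    by (simp add: fun_eq_iff A_coord_apply)
  have D: "Delta j (A_coord i k u) n = (shift j 1 (A_coord i k u) n + shift j (-1) (A_coord i k u) n) / 2"
    by (simp add: Delta_def)
  have "(p * ((a + a') / 2) - q * ((b + b') / 2)) / r = ((p * a - q * b) / r + (p * a' - q * b') / r) / 2"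
    for p q r a a' b b' :: complex
    by (simp add: add_divide_distrib diff_divide_distrib distrib_left mult_ac)
  then show "A_coord i k (Delta j u) n = Delta j (A_coord i k u) n"
    unfolding D A_coord_apply[of i k "Delta j u"] sD unfolding Ac sc
    by (simp only:)
qed

text \<open>A unit shift moves the coordinate by one, so the unbounded factors cancel in the
  commutator.\<close>

lemma A_coord_Delta_same:
  "\<i> * (Delta i (A_coord i k u) n - A_coord i k (Delta i u) n) = shift_sine i k u n"
proof -
  have [simp]: "axis i (c :: int) $ i = c" for c by (simp add: axis_def)
  have sD: "shift i a (Delta i u) n = (shift i (a + 1) u n + shift i (a - 1) u n) / 2" for a
  proof -
    have "shift i a (Delta i u) n = (shift i a (shift i 1 u) n + shift i a (shift i (-1) u) n) / 2"
      by (simp add: Delta_def shift_def)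
    then show ?thesis by (simp add: shift_add)
  qed
  have sc: "shift i b (A_coord i k u) n
     = ((2 * (of_int (n $ i) - of_int b) - of_nat k) * shift i (b + int k) u n
       - (2 * (of_int (n $ i) - of_int b) + of_nat k) * shift i (b - int k) u n) / (4 * \<i>)" for b
  proof -
    have "shift i b (A_coord i k u) n
     = ((2 * (of_int (n $ i) - of_int b) - of_nat k) * shift i b (shift i (int k) u) n
       - (2 * (of_int (n $ i) - of_int b) + of_nat k) * shift i b (shift i (- int k) u) n) / (4 * \<i>)"
      unfolding shift_def[of i b] A_coord_apply by simp
    then show ?thesis by (simp add: shift_add)
  qed
  have D: "Delta i (A_coord i k u) n = (shift i 1 (A_coord i k u) n + shift i (-1) (A_coord i k u) n) / 2"
    by (simp add: Delta_def)
  define p q r s where "p = shift i (int k + 1) u n" and "q = shift i (int k - 1) u n"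
    and "r = shift i (1 - int k) u n" and "s = shift i (- int k - 1) u n"
  have pq: "shift i (1 + int k) u n = p" "shift i (-1 + int k) u n = q"
    "shift i (- int k + 1) u n = r" "shift i (-1 - int k) u n = s"
    unfolding p_def q_def r_def s_def
    by (rule arg_cong[of _ _ "\<lambda>m. shift i m u n"], simp)+
  show ?thesis
    unfolding D sc A_coord_apply[of i k "Delta i u"] sD shift_sine_def
    unfolding pq p_def[symmetric] q_def[symmetric] r_def[symmetric] s_def[symmetric]
    by (simp add: field_simps)
qed

text \<open>The operator \<open>\<i> [MV, A_sum k]\<close>, in a form that shows it to be bounded on \<open>l2\<close>.\<close>

definition commutator :: "nat \<Rightarrow> 2 op" where
  "commutator k u = (\<lambda>n. shift_sine 1 k (Delta 2 u) n + shift_sine 2 k (Delta 1 u) n)"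

lemma UNIV_2_sum: "(\<Sum>i\<in>(UNIV::2 set). f i) = f 1 + f 2"
  by (simp add: UNIV_2)

lemma commutator_eq: "commutator k u n = \<i> * (MV (A_sum k u) n - A_sum k (MV u) n)"
proof -
  have A: "A_sum k v = (\<lambda>n. A_coord 1 k v n + A_coord 2 k v n)" for v :: "2 seq"
    by (simp add: A_sum_def UNIV_2_sum fun_eq_iff)
  have "MV (A_sum k u) n - A_sum k (MV u) n
    = (Delta 1 (A_coord 1 k (Delta 2 u)) n - A_coord 1 k (Delta 1 (Delta 2 u)) n)
    + (Delta 2 (A_coord 2 k (Delta 1 u)) n - A_coord 2 k (Delta 2 (Delta 1 u)) n)"
    unfolding A MV_apply Delta_add A_coord_Delta_other[of 1 2 k u, simplified]
      A_coord_Delta_other[of 2 1 k u, simplified] Delta_commute[of 2 1]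
    by simp
  moreover have "commutator k u n = \<i> * ((Delta 1 (A_coord 1 k (Delta 2 u)) n - A_coord 1 k (Delta 1 (Delta 2 u)) n)
    + (Delta 2 (A_coord 2 k (Delta 1 u)) n - A_coord 2 k (Delta 2 (Delta 1 u)) n))"
    by (simp only: commutator_def A_coord_Delta_same[symmetric] distrib_left)
  ultimately show ?thesis by simp
qed

lemma commutator_l2 [simp]: "u \<in> l2 \<Longrightarrow> commutator k u \<in> l2"
  unfolding commutator_def by (intro l2_add) simp_all

lemma commutator_norm_le:
  assumes "u \<in> l2" shows "l2_norm (commutator k u) \<le> 2 * l2_norm u"
  unfolding commutator_def
  using l2_norm_triangle[of "shift_sine 1 k (Delta 2 u)" "shift_sine 2 k (Delta 1 u)"]
    shift_sine_norm_le[of "Delta 2 u" 1 k] shift_sine_norm_le[of "Delta 1 u" 2 k]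
    Delta_norm_le[OF assms, of 1] Delta_norm_le[OF assms, of 2] assms
  by simp

lemma fin_supp_subset: "u \<in> fin_supp \<Longrightarrow> (\<And>n. v n \<noteq> 0 \<Longrightarrow> u n \<noteq> 0) \<Longrightarrow> v \<in> fin_supp"
  unfolding fin_supp_def by (auto elim: finite_subset[rotated])

lemma fin_supp_add: "u \<in> fin_supp \<Longrightarrow> v \<in> fin_supp \<Longrightarrow> (\<lambda>n. u n + v n) \<in> fin_supp"
  unfolding fin_supp_def
  by (auto intro: finite_subset[of _ "{n. u n \<noteq> 0} \<union> {n. v n \<noteq> 0}"])

lemma fin_supp_mult: "u \<in> fin_supp \<Longrightarrow> (\<lambda>n. c n * u n) \<in> fin_supp"
  by (erule fin_supp_subset) auto

lemma fin_supp_diff: "u \<in> fin_supp \<Longrightarrow> v \<in> fin_supp \<Longrightarrow> (\<lambda>n. u n - v n) \<in> fin_supp"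
  using fin_supp_add[OF _ fin_supp_mult[of v "\<lambda>_. -1"]] by simp

lemma fin_supp_divide: "u \<in> fin_supp \<Longrightarrow> (\<lambda>n. u n / c) \<in> fin_supp"
  by (erule fin_supp_subset) auto

lemma fin_supp_shift: "u \<in> fin_supp \<Longrightarrow> shift i k u \<in> fin_supp"
proof -
  assume "u \<in> fin_supp"
  then have "finite ((\<lambda>n. n + axis i k) ` {n. u n \<noteq> 0})" by (simp add: fin_supp_def)
  moreover have "{n. shift i k u n \<noteq> 0} \<subseteq> (\<lambda>n. n + axis i k) ` {n. u n \<noteq> 0}"
    by (auto simp: shift_def image_iff intro!: exI[of _ "_ - axis i k"])
  ultimately show ?thesis unfolding fin_supp_def using finite_subset by blast
qed

lemma fin_supp_MV: "u \<in> fin_supp \<Longrightarrow> MV (u :: 2 seq) \<in> fin_supp"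
  unfolding MV_apply Delta_def by (intro fin_supp_divide fin_supp_add fin_supp_shift)

lemma fin_supp_A_sum: "u \<in> fin_supp \<Longrightarrow> A_sum k (u :: 2 seq) \<in> fin_supp"
  unfolding A_sum_def UNIV_2_sum A_coord_apply
  by (intro fin_supp_add fin_supp_divide fin_supp_diff fin_supp_mult fin_supp_shift)

section \<open>Plane waves on boxes\<close>

text \<open>Shifts are isometries, so the errors of successive unit shifts add up, and inverse shifts cost
  nothing more.\<close>

lemma shift_power_approx:
  fixes u :: "('d::finite) seq"
  assumes u: "u \<in> l2" and e: "l2_norm (\<lambda>n. shift i 1 u n - cis (- t) * u n) \<le> e"
  shows "l2_norm (\<lambda>n. shift i k u n - cis (- (of_int k * t)) * u n) \<le> \<bar>of_int k\<bar> * e"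
proof -
  have pos: "l2_norm (\<lambda>n. shift i (int m) u n - cis (- (real m * t)) * u n) \<le> real m * e" for m
  proof (induction m)
    case 0
    then show ?case by (simp add: l2_norm_def)
  next
    case (Suc m)
    let ?z = "cis (- (real m * t))"
    have eq: "shift i (int (Suc m)) u n - cis (- (real (Suc m) * t)) * u n
      = shift i 1 (\<lambda>n. shift i (int m) u n - ?z * u n) n + ?z * (shift i 1 u n - cis (- t) * u n)" for n
    proof -
      have "shift i 1 (\<lambda>n. shift i (int m) u n - ?z * u n) n
          = shift i 1 (shift i (int m) u) n - ?z * shift i 1 u n"
        by (simp add: shift_def)
      moreover have "cis (- (real (Suc m) * t)) = ?z * cis (- t)"
        by (simp add: cis_mult algebra_simps)
      ultimately show ?thesis by (simp add: shift_add algebra_simps)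
    qed
    have "l2_norm (\<lambda>n. shift i (int (Suc m)) u n - cis (- (real (Suc m) * t)) * u n)
      \<le> l2_norm (shift i 1 (\<lambda>n. shift i (int m) u n - ?z * u n))
        + l2_norm (\<lambda>n. ?z * (shift i 1 u n - cis (- t) * u n))"
      unfolding eq using u by (intro l2_norm_triangle l2_scale l2_diff) (simp_all add: l2_diff l2_scale)
    also have "\<dots> \<le> real m * e + e"
      using Suc e by (simp add: l2_norm_scale)
    finally show ?case by (simp add: algebra_simps)
  qed
  show ?thesis
  proof (cases "k \<ge> 0")
    case True
    then show ?thesis using pos[of "nat k"] by simp
  next
    case False
    define m where "m = nat (- k)"
    have k: "k = - int m" using False by (simp add: m_def)
    let ?z = "cis (- (real m * t))"
    have "l2_norm (\<lambda>n. shift i k u n - cis (- (of_int k * t)) * u n)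
        = l2_norm (shift i (int m) (\<lambda>n. shift i k u n - cnj ?z * u n))"
      by (simp add: k cis_cnj)
    also have "shift i (int m) (\<lambda>n. shift i k u n - cnj ?z * u n)
        = (\<lambda>n. shift i (int m) (shift i k u) n - cnj ?z * shift i (int m) u n)"
      by (simp add: shift_def)
    also have "\<dots> = (\<lambda>n. (- cnj ?z) * (shift i (int m) u n - ?z * u n))"
      by (simp add: shift_add k fun_eq_iff algebra_simps cis_cnj cis_mult)
    also have "l2_norm \<dots> = l2_norm (\<lambda>n. shift i (int m) u n - ?z * u n)"
      by (subst l2_norm_scale) simp
    also have "\<dots> \<le> real m * e" by (rule pos)
    finally show ?thesis by (simp add: k)
  qed
qed

lemma Delta_approx:
  fixes u :: "('d::finite) seq"
  assumes u: "u \<in> l2" and e: "l2_norm (\<lambda>n. shift i 1 u n - cis (- t) * u n) \<le> e"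
  shows "l2_norm (\<lambda>n. Delta i u n - of_real (cos t) * u n) \<le> e"
proof -
  let ?a = "\<lambda>k n. shift i k u n - cis (- (of_int k * t)) * u n"
  have eq: "Delta i u n - of_real (cos t) * u n = (?a 1 n + ?a (-1) n) / 2" for n
  proof -
    have "complex_of_real (cos t) = (cis t + cis (- t)) / 2" by (simp add: complex_eq_iff)
    then show ?thesis by (simp add: Delta_def field_simps)
  qed
  have "l2_norm (\<lambda>n. ?a 1 n + ?a (-1) n) \<le> l2_norm (?a 1) + l2_norm (?a (-1))"
    using u by (intro l2_norm_triangle l2_diff l2_scale) simp_all
  also have "\<dots> \<le> e + e"
    using shift_power_approx[OF u e, of 1] shift_power_approx[OF u e, of "-1"] by (intro add_mono) simp_all
  finally show ?thesis unfolding eq by (simp add: l2_norm_divide)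
qed

lemma shift_sine_approx:
  fixes u :: "('d::finite) seq"
  assumes u: "u \<in> l2" and e: "l2_norm (\<lambda>n. shift i 1 u n - cis (- t) * u n) \<le> e"
  shows "l2_norm (\<lambda>n. shift_sine i k u n - of_real (sin t * sin (real k * t)) * u n) \<le> (real k + 1) * e"
proof -
  have e0: "0 \<le> e" using e l2_norm_ge_0 order_trans by blast
  define a where "a m = (\<lambda>n. shift i m u n - cis (- (of_int m * t)) * u n)" for m :: int
  have a: "a m \<in> l2" "l2_norm (a m) \<le> \<bar>of_int m\<bar> * e" for m
    unfolding a_def using u shift_power_approx[OF u e] by (auto intro!: l2_diff l2_scale)
  have a': "l2_norm (a m) \<le> (real k + 1) * e" if "\<bar>m\<bar> \<le> int k + 1" for m
  proof -
    have "\<bar>real_of_int m\<bar> \<le> real k + 1" using that by linarith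
    then show ?thesis using a(2)[of m] mult_right_mono[OF _ e0] order_trans by blast
  qed
  have eq: "shift_sine i k u n - of_real (sin t * sin (real k * t)) * u n
    = (((a (int k - 1) n + a (1 - int k) n) - a (int k + 1) n) - a (- int k - 1) n) / 4" for n
  proof -
    let ?p = "real k * t - t" and ?q = "real k * t + t"
    have "complex_of_real (sin t * sin (real k * t)) = (cis (- ?p) + cis ?p - cis (- ?q) - cis ?q) / 4"
      by (simp add: complex_eq_iff cos_diff cos_add sin_diff sin_add)
    moreover have "cis (- (of_int (int k - 1) * t)) = cis (- ?p)" "cis (- (of_int (1 - int k) * t)) = cis ?p"
      "cis (- (of_int (int k + 1) * t)) = cis (- ?q)" "cis (- (of_int (- int k - 1) * t)) = cis ?q"
      by (simp_all add: algebra_simps)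
    ultimately have "shift_sine i k u n - of_real (sin t * sin (real k * t)) * u n
      = (shift i (int k - 1) u n + shift i (1 - int k) u n
      - shift i (int k + 1) u n - shift i (- int k - 1) u n) / 4
      - (cis (- ?p) + cis ?p - cis (- ?q) - cis ?q) / 4 * u n"
      and "(((a (int k - 1) n + a (1 - int k) n) - a (int k + 1) n) - a (- int k - 1) n) / 4
      = (((shift i (int k - 1) u n - cis (- ?p) * u n + (shift i (1 - int k) u n - cis ?p * u n))
       - (shift i (int k + 1) u n - cis (- ?q) * u n)) - (shift i (- int k - 1) u n - cis ?q * u n)) / 4"
      unfolding a_def shift_sine_def by (simp_all only:)
    moreover have "(A + B - C - D) / 4 - (z1 + z2 - z3 - z4) / 4 * y
      = (((A - z1 * y + (B - z2 * y)) - (C - z3 * y)) - (D - z4 * y)) / 4" for A B C D z1 z2 z3 z4 y :: complex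
      by (simp add: field_simps)
    ultimately show ?thesis by (simp only:)
  qed
  have "l2_norm (\<lambda>n. ((a (int k - 1) n + a (1 - int k) n) - a (int k + 1) n) - a (- int k - 1) n)
    \<le> l2_norm (a (int k - 1)) + l2_norm (a (1 - int k)) + l2_norm (a (int k + 1)) + l2_norm (a (- int k - 1))"
    using l2_norm_diff_le[OF l2_diff[OF l2_add[OF a(1) a(1)] a(1)] a(1), of "int k - 1" "1 - int k" "int k + 1" "- int k - 1"]
     l2_norm_diff_le[OF l2_add[OF a(1) a(1)] a(1), of "int k - 1" "1 - int k" "int k + 1"]
     l2_norm_triangle[OF a(1) a(1), of "int k - 1" "1 - int k"] by linarith
  also have "\<dots> \<le> 4 * ((real k + 1) * e)"
  proof -
    have "\<bar>int k - 1\<bar> \<le> int k + 1" "\<bar>1 - int k\<bar> \<le> int k + 1" "\<bar>int k + 1\<bar> \<le> int k + 1"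
      "\<bar>- int k - 1\<bar> \<le> int k + 1" by linarith+
    from this[THEN a'] show ?thesis by linarith
  qed
  finally show ?thesis unfolding eq by (simp add: l2_norm_divide)
qed

text \<open>The contraction \<open>X\<close> does not enlarge the error of \<open>Y\<close>, nor does the factor \<open>b\<close> enlarge that
  of \<open>X\<close>.\<close>

lemma comp_approx:
  fixes u :: "('d::finite) seq" and a b :: real
  assumes u: "u \<in> l2" "Y u \<in> l2" "X u \<in> l2"
    and Y: "l2_norm (\<lambda>n. Y u n - of_real b * u n) \<le> e"
    and X: "l2_norm (\<lambda>n. X u n - of_real a * u n) \<le> f"
    and X_lin: "X (\<lambda>n. Y u n - of_real b * u n) = (\<lambda>n. X (Y u) n - of_real b * X u n)"
    and X_l2: "\<And>v. v \<in> l2 \<Longrightarrow> X v \<in> l2"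
    and X_le: "\<And>v. v \<in> l2 \<Longrightarrow> l2_norm (X v) \<le> l2_norm v" and b: "\<bar>b\<bar> \<le> 1"
  shows "l2_norm (\<lambda>n. X (Y u) n - of_real (a * b) * u n) \<le> e + f"
proof -
  have "l2_norm (\<lambda>n. X (Y u) n - of_real (a * b) * u n)
     = l2_norm (\<lambda>n. X (\<lambda>n. Y u n - of_real b * u n) n + of_real b * (X u n - of_real a * u n))"
    unfolding X_lin by (simp add: algebra_simps)
  also have "\<dots> \<le> l2_norm (X (\<lambda>n. Y u n - of_real b * u n)) + l2_norm (\<lambda>n. of_real b * (X u n - of_real a * u n))"
    using u by (intro l2_norm_triangle X_l2 l2_scale l2_diff)
  also have "l2_norm (X (\<lambda>n. Y u n - of_real b * u n)) \<le> e"
    using X_le[OF l2_diff[OF u(2) l2_scale[OF u(1)]], of "of_real b"] Y by simp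
  also have "l2_norm (\<lambda>n. of_real b * (X u n - of_real a * u n)) \<le> f"
    unfolding l2_norm_scale using X b mult_left_le_one_le[of "l2_norm (\<lambda>n. X u n - of_real a * u n)" "\<bar>b\<bar>"]
    by simp
  finally show ?thesis by simp
qed

lemma Delta_diff_scale: "Delta i (\<lambda>n. u n - c * v n) = (\<lambda>n. Delta i u n - c * Delta i v n)"
  by (simp add: Delta_def shift_def fun_eq_iff field_simps)

lemma shift_sine_diff_scale:
  "shift_sine i k (\<lambda>n. u n - c * v n) = (\<lambda>n. shift_sine i k u n - c * shift_sine i k v n)"
  by (simp add: shift_sine_diff shift_sine_scale)

lemma g_cos:
  fixes x :: "real ^ 2"
  assumes "\<And>i. x $ i = cos (t i)" and "k \<ge> 1"
  shows "g k x = cos (t 2) * (sin (t 1) * sin (real k * t 1)) + cos (t 1) * (sin (t 2) * sin (real k * t 2))"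
proof -
  have U: "(1 - (cos s)\<^sup>2) * chebyshev_U (k - 1) (cos s) = sin s * sin (real k * s)" for s
  proof -
    have "1 - (cos s)\<^sup>2 = sin s * sin s" using sin_squared_eq[of s] by (simp add: power2_eq_square)
    moreover have "sin s * chebyshev_U (k - 1) (cos s) = sin (real k * s)"
      using chebyshev_U_cos[of "k - 1" s] assms(2) by (simp add: mult.commute)
    ultimately show ?thesis by (simp only: mult.assoc)
  qed
  have S: "UNIV - {1::2} = {2}" "UNIV - {2::2} = {1}" by (auto simp: UNIV_2)
  show ?thesis
    unfolding g_def UNIV_2_sum S using assms(1) U by (simp add: mult.assoc)
qed

lemma plane_wave_eigenvalues:
  fixes u :: "2 seq" and x :: "real ^ 2"
  assumes u: "u \<in> l2" and e: "\<And>i. l2_norm (\<lambda>n. shift i 1 u n - cis (- t i) * u n) \<le> e"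
    and x: "\<And>i. x $ i = cos (t i)"
  shows MV_approx: "l2_norm (\<lambda>n. MV u n - of_real (x $ 1 * x $ 2) * u n) \<le> 2 * e"
    and commutator_approx: "k \<ge> 1 \<Longrightarrow> l2_norm (\<lambda>n. commutator k u n - of_real (g k x) * u n) \<le> (2 * real k + 4) * e"
proof -
  note D = Delta_approx[OF u e] and S = shift_sine_approx[OF u e]
  show "l2_norm (\<lambda>n. MV u n - of_real (x $ 1 * x $ 2) * u n) \<le> 2 * e"
    unfolding MV_apply x
    using comp_approx[where X = "Delta 1" and Y = "Delta 2", OF u _ _ D D Delta_diff_scale] u
    by (simp add: Delta_norm_le)
  have SD: "l2_norm (\<lambda>n. shift_sine i k (Delta j u) n
      - of_real ((sin (t i) * sin (real k * t i)) * cos (t j)) * u n) \<le> e + (real k + 1) * e" for i j k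
    by (rule comp_approx[where X = "shift_sine i k" and Y = "Delta j", OF u _ _ D S shift_sine_diff_scale])
      (use u in \<open>simp_all add: shift_sine_norm_le\<close>)
  assume k: "k \<ge> 1"
  let ?a = "\<lambda>i j n. shift_sine i k (Delta j u) n - of_real ((sin (t i) * sin (real k * t i)) * cos (t j)) * u n"
  have "commutator k u n - of_real (g k x) * u n = ?a 1 2 n + ?a 2 1 n" for n
    unfolding commutator_def g_cos[OF x k] by (simp add: algebra_simps)
  then have "l2_norm (\<lambda>n. commutator k u n - of_real (g k x) * u n) \<le> l2_norm (?a 1 2) + l2_norm (?a 2 1)"
    using l2_norm_triangle[of "?a 1 2" "?a 2 1"] u by (simp add: l2_diff l2_scale)
  also have "\<dots> \<le> (e + (real k + 1) * e) + (e + (real k + 1) * e)"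
    using SD by (intro add_mono)
  finally show "l2_norm (\<lambda>n. commutator k u n - of_real (g k x) * u n) \<le> (2 * real k + 4) * e"
    by (simp add: algebra_simps)
qed

lemma card_box:
  fixes X Y :: "int set"
  assumes "finite X" and "finite Y"
  shows "finite {n :: int ^ 2. n $ 1 \<in> X \<and> n $ 2 \<in> Y}"
    and "card {n :: int ^ 2. n $ 1 \<in> X \<and> n $ 2 \<in> Y} = card X * card Y"
proof -
  have bij: "bij_betw (\<lambda>n :: int ^ 2. (n $ 1, n $ 2)) {n. n $ 1 \<in> X \<and> n $ 2 \<in> Y} (X \<times> Y)"
    by (rule bij_betw_byWitness[of _ "\<lambda>(p, q). vector [p, q]"])
      (auto simp: vec_eq_iff forall_2)
  show "finite {n :: int ^ 2. n $ 1 \<in> X \<and> n $ 2 \<in> Y}"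
    using bij_betw_finite[OF bij] assms by (simp only: finite_cartesian_product)
  show "card {n :: int ^ 2. n $ 1 \<in> X \<and> n $ 2 \<in> Y} = card X * card Y"
    using bij_betw_same_card[OF bij] by (simp only: card_cartesian_product)
qed

lemma l2_norm_unimodular:
  assumes "finite S" and "\<And>n. cmod (u n) = (if n \<in> S then 1 else 0)"
  shows "l2_norm u = sqrt (card S)"
proof -
  have "(\<Sum>\<^sub>\<infinity>n. (cmod (u n))\<^sup>2) = (\<Sum>\<^sub>\<infinity>n\<in>S. 1)"
    by (rule infsum_cong_neutral) (auto simp: assms(2))
  then show ?thesis using assms(1) by (simp add: l2_norm_def)
qed

text \<open>Cutting a plane wave off to a box of side \<open>N\<close> gives norm \<open>N\<close>, while a unit shift only changes
  it on the \<open>2 * N\<close> lattice points of two opposite faces.\<close>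

lemma plane_wave_approx:
  fixes t :: "2 \<Rightarrow> real"
  assumes "\<epsilon> > 0"
  obtains u :: "2 seq" where "u \<in> fin_supp" and "0 < l2_norm u"
    and "\<And>i. l2_norm (\<lambda>n. shift i 1 u n - cis (- t i) * u n) \<le> \<epsilon> * l2_norm u"
proof -
  obtain N :: nat where N: "2 / \<epsilon>\<^sup>2 < real N" using reals_Archimedean2 by blast
  have N0: "0 < real N" using N assms by (smt (verit) divide_pos_pos zero_less_power)
  define b where "b = {n :: int ^ 2. n $ 1 \<in> {0..<int N} \<and> n $ 2 \<in> {0..<int N}}"
  define u :: "2 seq" where
    "u = (\<lambda>n. if n \<in> b then cis (t 1 * of_int (n $ 1) + t 2 * of_int (n $ 2)) else 0)"
  have b: "finite b" "card b = N * N"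
    unfolding b_def using card_box[of "{0..<int N}" "{0..<int N}"] by simp_all
  have nu: "l2_norm u = real N"
    using l2_norm_unimodular[of b u] b by (simp add: u_def)
  have face: "l2_norm (\<lambda>n. shift i 1 u n - cis (- t i) * u n) = sqrt (2 * real N)" for i
  proof -
    define F where "F = (if i = 1 then {n :: int ^ 2. n $ 1 \<in> {0, int N} \<and> n $ 2 \<in> {0..<int N}}
       else {n. n $ 1 \<in> {0..<int N} \<and> n $ 2 \<in> {0, int N}})"
    have F: "finite F" "card F = 2 * N"
      unfolding F_def using N0 card_box[of "{0, int N}" "{0..<int N}"] card_box[of "{0..<int N}" "{0, int N}"]
      by (auto simp: mult.commute)
    have i: "i = 1 \<or> i = 2" using exhaust_2 by blast
    have wave: "cis (t 1 * of_int ((n - axis i 1) $ 1) + t 2 * of_int ((n - axis i 1) $ 2))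
      = cis (- t i) * cis (t 1 * of_int (n $ 1) + t 2 * of_int (n $ 2))" for n :: "int ^ 2"
      using i by (auto simp: cis_mult axis_def algebra_simps)
    have mem: "n \<in> F \<longleftrightarrow> (n - axis i 1 \<in> b) \<noteq> (n \<in> b)" for n
      using i N0 by (auto simp: F_def b_def axis_def)
    \<comment> \<open>Where the shifted and the original wave are both present, they differ by the phase only.\<close>
    have "cmod (shift i 1 u n - cis (- t i) * u n) = (if n \<in> F then 1 else 0)" for n
      unfolding mem shift_def u_def wave by (auto simp: norm_mult)
    from l2_norm_unimodular[OF F(1) this] show ?thesis by (simp add: F(2))
  qed
  have le: "sqrt (2 * real N) \<le> \<epsilon> * real N"
  proof (rule real_le_lsqrt)
    show "2 * real N \<le> (\<epsilon> * real N)\<^sup>2"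
      using N N0 assms by (simp add: power_mult_distrib field_simps power2_eq_square)
  qed (use assms in simp)
  show thesis
  proof
    show "u \<in> fin_supp" unfolding fin_supp_def u_def using b(1) by (auto intro: finite_subset[of _ b])
    show "0 < l2_norm u" using nu N0 by simp
    show "l2_norm (\<lambda>n. shift i 1 u n - cis (- t i) * u n) \<le> \<epsilon> * l2_norm u" for i
      unfolding face nu by (rule le)
  qed
qed

section \<open>The commutator at a point of the energy surface\<close>

text \<open>The index is moved to \<open>Suc j\<close> because the combination starts at \<open>j = 1\<close> and the coefficient
  \<open>\<rho> 0\<close> is arbitrary.\<close>

lemma conj_comb_pointwise:
  fixes A :: "2 op"
  assumes A: "conj_comb \<kappa> \<rho> A" and u: "u \<in> fin_supp"
  shows "(\<lambda>J. \<Sum>j<J. of_real (\<rho> (Suc j)) * A_sum (Suc j * \<kappa>) u n) \<longlonglongrightarrow> A u n"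
proof -
  have Au: "A u \<in> l2"
    and lim: "l2_lim (\<lambda>J n. \<Sum>j=1..J. of_real (\<rho> j) * A_sum (j * \<kappa>) u n) (A u)"
    using A u unfolding conj_comb_def by blast+
  have "(\<lambda>n. \<Sum>j=1..J. of_real (\<rho> j) * A_sum (j * \<kappa>) u n) \<in> l2" for J
    using u by (intro l2_sum(1) l2_scale fin_supp_l2 fin_supp_A_sum) auto
  from l2_lim_pointwise[OF lim this Au]
  show ?thesis by (simp add: sum.atLeast1_atMost_eq)
qed

definition delta :: "2 seq" where
  "delta = (\<lambda>n. if n = 0 then 1 else 0)"

lemma delta_fin_supp: "delta \<in> fin_supp"
  by (simp add: fin_supp_def delta_def)

lemma A_sum_delta:
  assumes "m > 0" and "k > 0"
  shows "A_sum k delta (axis 1 (int m)) = (if m = k then of_nat k / (4 * \<i>) else 0)"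
proof -
  have "axis 1 (int m) - axis 1 (int k) = (0 :: int ^ 2) \<longleftrightarrow> m = k"
    "axis 1 (int m) - axis 1 (- int k) \<noteq> (0 :: int ^ 2)"
    "axis 1 (int m) - axis 2 c \<noteq> (0 :: int ^ 2)" for c
    using assms by (auto simp: vec_eq_iff axis_def forall_2)
  then have d: "delta (axis 1 (int m) - axis 1 (int k)) = (if m = k then 1 else 0)"
    "delta (axis 1 (int m) - axis 1 (- int k)) = 0" "delta (axis 1 (int m) - axis 2 c) = 0" for c
    unfolding delta_def by meson+
  have e: "axis 1 (int m) $ 1 = int m" by (simp add: axis_def)
  show ?thesis
    unfolding A_sum_def UNIV_2_sum A_coord_apply shift_def d e by simp
qed

text \<open>Applied to the unit vector at the origin, the series for \<open>A\<close> has orthogonal terms of norm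
  comparable to \<open>j * \<bar>\<rho> j\<bar>\<close>, so its convergence makes \<open>j * \<rho> j\<close> square summable.\<close>

lemma conj_comb_summable:
  fixes A :: "2 op"
  assumes \<kappa>: "\<kappa> > 0" and A: "conj_comb \<kappa> \<rho> A"
  shows "summable (\<lambda>j. \<bar>\<rho> (Suc j)\<bar>)"
proof -
  \<comment> \<open>On the first axis, the only term of the series that is not zero at \<open>h j\<close> is number \<open>Suc j\<close>.\<close>
  define h where "h = (\<lambda>j. axis 1 (int (Suc j * \<kappa>)) :: int ^ 2)"
  have inj: "inj h"
  proof (rule injI)
    fix i j assume "h i = h j"
    then have "h i $ 1 = h j $ 1" by simp
    then have "Suc i * \<kappa> = Suc j * \<kappa>" by (simp only: h_def axis_def vec_lambda_beta if_True simp_thms of_nat_eq_iff)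
    then show "i = j" using \<kappa> by simp
  qed
  define a where "a = (\<lambda>j. A delta (h j))"
  have a: "a j = of_real (\<rho> (Suc j)) * (of_nat (Suc j * \<kappa>) / (4 * \<i>))" for j
  proof -
    have "A_sum (Suc i * \<kappa>) delta (h j) = (if i = j then of_nat (Suc j * \<kappa>) / (4 * \<i>) else 0)" for i
      using \<kappa> A_sum_delta[of "Suc j * \<kappa>" "Suc i * \<kappa>"] by (auto simp: h_def simp del: mult_Suc)
    then have "(\<Sum>i<J. of_real (\<rho> (Suc i)) * A_sum (Suc i * \<kappa>) delta (h j))
        = of_real (\<rho> (Suc j)) * (of_nat (Suc j * \<kappa>) / (4 * \<i>))" if "J \<ge> Suc j" for J
      using that by (simp add: if_distrib[of "\<lambda>x. _ * x"] sum.delta cong: if_cong)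
    then have "(\<lambda>J. \<Sum>i<J. of_real (\<rho> (Suc i)) * A_sum (Suc i * \<kappa>) delta (h j))
        \<longlonglongrightarrow> of_real (\<rho> (Suc j)) * (of_nat (Suc j * \<kappa>) / (4 * \<i>))"
      by (intro tendsto_eventually) (auto simp: eventually_sequentially)
    with conj_comb_pointwise[OF A delta_fin_supp, of "h j"] show ?thesis
      unfolding a_def by (rule LIMSEQ_unique)
  qed
  have "A delta \<in> l2" using A delta_fin_supp unfolding conj_comb_def by blast
  then have "(\<lambda>n. (cmod (A delta n))\<^sup>2) summable_on range h"
    unfolding l2_def using summable_on_subset_banach by blast
  then have "(\<lambda>j. (cmod (a j))\<^sup>2) summable_on UNIV"
    using summable_on_reindex[OF inj, of "\<lambda>n. (cmod (A delta n))\<^sup>2"] by (simp add: a_def o_def)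
  then have "summable (\<lambda>j. (cmod (a j))\<^sup>2)"
    by (rule summable_on_imp_summable)
  then have "summable (\<lambda>j. 2 / real \<kappa> * ((cmod (a j))\<^sup>2 + inverse (real (Suc j) ^ 2)))"
    using inverse_power_summable[of 2, where 'a = real]
    by (intro summable_mult summable_add) (simp_all only: summable_Suc_iff[of "\<lambda>j. inverse (real j ^ 2)"] order_refl)
  then show ?thesis
  proof (rule summable_comparison_test')
    fix j
    define x where "x = real (Suc j)"
    have x: "x > 0" by (simp add: x_def)
    have ca: "cmod (a j) = \<bar>\<rho> (Suc j)\<bar> * (x * real \<kappa> / 4)"
      unfolding a by (simp add: norm_mult norm_divide x_def del: of_nat_Suc mult_Suc)
    \<comment> \<open>An arithmetic-geometric mean bounds \<open>\<bar>\<rho> (Suc j)\<bar>\<close> by two summable terms.\<close>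
    have "2 * (cmod (a j) * inverse x) \<le> (cmod (a j))\<^sup>2 + (inverse x)\<^sup>2"
      using sum_squares_bound[of "cmod (a j)" "inverse x"] by simp
    moreover have "cmod (a j) * inverse x = \<bar>\<rho> (Suc j)\<bar> * (real \<kappa> / 4)"
      unfolding ca using x by (simp add: field_simps)
    moreover have "p * k \<le> 2 * s" if "2 * q \<le> s" "q = p * (k / 4)" for p q k s :: real
    proof -
      have "p * k = 4 * q" using that(2) by simp
      then show ?thesis using that(1) by linarith
    qed
    ultimately have "\<bar>\<rho> (Suc j)\<bar> * real \<kappa> \<le> 2 * ((cmod (a j))\<^sup>2 + (inverse x)\<^sup>2)"
      by blast
    then have "\<bar>\<rho> (Suc j)\<bar> \<le> 2 * ((cmod (a j))\<^sup>2 + (inverse x)\<^sup>2) / real \<kappa>"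
      using \<kappa> by (subst pos_le_divide_eq) simp_all
    then show "norm \<bar>\<rho> (Suc j)\<bar> \<le> 2 / real \<kappa> * ((cmod (a j))\<^sup>2 + inverse (real (Suc j) ^ 2))"
      by (simp add: x_def power_inverse)
  qed
qed

lemma MV_sum:
  "MV (\<lambda>n. \<Sum>j\<in>J. c j * v j n) = (\<lambda>n. \<Sum>j\<in>J. c j * MV (v j) n)"
  for v :: "'a \<Rightarrow> 2 seq"
proof -
  have D: "Delta i (\<lambda>n. \<Sum>j\<in>J. c j * v j n) = (\<lambda>n. \<Sum>j\<in>J. c j * Delta i (v j) n)"
    for v :: "'a \<Rightarrow> 2 seq" and i
    by (simp add: Delta_def shift_def fun_eq_iff sum.distrib[symmetric] sum_divide_distrib distrib_left)
  show ?thesis unfolding MV_apply D ..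
qed

lemma MV_pointwise_limit:
  assumes "\<And>n. (\<lambda>J. us J n) \<longlonglongrightarrow> u n"
  shows "(\<lambda>J. MV (us J) n) \<longlonglongrightarrow> MV (u :: 2 seq) n"
  unfolding MV_apply Delta_def shift_def by (intro tendsto_intros assms) simp_all

lemma commutator_pointwise:
  fixes A B :: "2 op"
  assumes A: "conj_comb \<kappa> \<rho> A" and B: "commutator_ext MV A B" and u: "u \<in> fin_supp"
  shows "(\<lambda>J. \<Sum>j<J. of_real (\<rho> (Suc j)) * commutator (Suc j * \<kappa>) u n) \<longlonglongrightarrow> B u n"
proof -
  have Bu: "B u n = \<i> * (MV (A u) n - A (MV u) n)"
    using B u unfolding commutator_ext_def by simp
  have "(\<lambda>J. \<i> * (MV (\<lambda>n. \<Sum>j<J. of_real (\<rho> (Suc j)) * A_sum (Suc j * \<kappa>) u n) n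
        - (\<Sum>j<J. of_real (\<rho> (Suc j)) * A_sum (Suc j * \<kappa>) (MV u) n)))
      \<longlonglongrightarrow> B u n"
    unfolding Bu using u
    by (intro tendsto_intros MV_pointwise_limit conj_comb_pointwise[OF A] fin_supp_MV)
  moreover have "\<i> * (MV (\<lambda>n. \<Sum>j<J. of_real (\<rho> (Suc j)) * A_sum (Suc j * \<kappa>) u n) n
        - (\<Sum>j<J. of_real (\<rho> (Suc j)) * A_sum (Suc j * \<kappa>) (MV u) n))
      = (\<Sum>j<J. of_real (\<rho> (Suc j)) * commutator (Suc j * \<kappa>) u n)" for J
    unfolding MV_sum commutator_eq sum_subtractf[symmetric] sum_distrib_left
    by (intro sum.cong refl) (simp only: right_diff_distrib mult_ac)
  ultimately show ?thesis by simp
qed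

lemma abs_g_le:
  fixes x :: "real ^ 2"
  assumes x: "\<And>i. x $ i = cos (t i)" and k: "k \<ge> 1"
  shows "\<bar>g k x\<bar> \<le> 2"
proof -
  have "\<bar>a * (b * c)\<bar> \<le> 1" if "\<bar>a\<bar> \<le> 1" "\<bar>b\<bar> \<le> 1" "\<bar>c\<bar> \<le> 1" for a b c :: real
    using that by (simp add: abs_mult mult_le_one)
  from this[of "cos (t 2)" "sin (t 1)" "sin (real k * t 1)"]
    this[of "cos (t 1)" "sin (t 2)" "sin (real k * t 2)"]
  show ?thesis unfolding g_cos[OF x k] by simp
qed

text \<open>The single terms of the series for \<open>B\<close> have plane waves as approximate eigenvectors, but with
  errors that grow with \<open>j\<close>. The series is therefore cut at \<open>J0\<close>: absolute summability of \<open>\<rho>\<close>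
  controls the tail by the uniform bound on the terms, and the box is then chosen for the first
  \<open>J0\<close> terms.\<close>

lemma mourre_commutator_approx:
  fixes A B :: "2 op" and x :: "real ^ 2"
  assumes \<kappa>: "\<kappa> > 0" and A: "conj_comb \<kappa> \<rho> A" and B: "commutator_ext MV A B"
    and x: "\<And>i. x $ i = cos (t i)" and \<epsilon>: "\<epsilon> > 0"
  obtains u where "u \<in> fin_supp" and "0 < l2_norm u"
    and "l2_norm (\<lambda>n. MV u n - of_real (x $ 1 * x $ 2) * u n) \<le> \<epsilon> * l2_norm u"
    and "l2_norm (\<lambda>n. B u n - of_real (\<Sum>j. \<rho> (Suc j) * g (Suc j * \<kappa>) x) * u n) \<le> \<epsilon> * l2_norm u"
proof -
  define r where "r = (\<lambda>j. \<bar>\<rho> (Suc j)\<bar>)"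
  define G where "G = (\<lambda>j. g (Suc j * \<kappa>) x)"
  have r: "summable r" unfolding r_def by (rule conj_comb_summable[OF \<kappa> A])
  have r0: "r j \<ge> 0" for j by (simp add: r_def)
  have k1: "Suc j * \<kappa> \<ge> 1" for j using \<kappa> by simp
  have G2: "\<bar>G j\<bar> \<le> 2" for j unfolding G_def by (rule abs_g_le[OF x k1])
  have sG: "summable (\<lambda>j. \<rho> (Suc j) * G j)"
    by (rule summable_comparison_test'[OF summable_mult[OF r, of 2]])
      (use G2 in \<open>simp add: r_def abs_mult mult.commute mult_right_mono\<close>)
  from r \<epsilon> obtain J0 where "\<And>m n. m \<ge> J0 \<Longrightarrow> norm (sum r {m..<n}) < \<epsilon> / 8"
    unfolding summable_Cauchy by (metis zero_less_divide_iff zero_less_numeral)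
  then have tail: "sum r {J0..<n} \<le> \<epsilon> / 8" for n
    by (metis abs_ge_self less_eq_real_def order_trans real_norm_def order_refl)
  define K where "K = (\<lambda>j. 2 * real (Suc j * \<kappa>) + 4)"
  define M where "M = (\<Sum>j<J0. r j * K j)"
  have M: "M \<ge> 0" unfolding M_def K_def using r0 by (intro sum_nonneg mult_nonneg_nonneg) auto
  define e where "e = \<epsilon> / (2 * (M + 1))"
  have e: "e > 0" "2 * e \<le> \<epsilon>" "M * e \<le> \<epsilon> / 2"
    unfolding e_def using \<epsilon> M by (auto simp: field_simps)
  obtain u :: "2 seq" where u: "u \<in> fin_supp" "0 < l2_norm u"
    and wave: "\<And>i. l2_norm (\<lambda>n. shift i 1 u n - cis (- t i) * u n) \<le> e * l2_norm u"
    using plane_wave_approx[OF e(1), of t] by blast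
  have ul2 [simp]: "u \<in> l2" using u(1) by (rule fin_supp_l2)
  define d where "d = (\<lambda>j n. commutator (Suc j * \<kappa>) u n - of_real (G j) * u n)"
  have d_l2 [simp]: "d j \<in> l2" for j unfolding d_def by (intro l2_diff l2_scale) simp_all
  have d1: "l2_norm (d j) \<le> K j * e * l2_norm u" for j
    unfolding d_def G_def K_def using commutator_approx[OF ul2 wave x k1, of j] by (simp only: mult.assoc)
  have d2: "l2_norm (d j) \<le> 4 * l2_norm u" for j
  proof -
    have "l2_norm (d j) \<le> l2_norm (commutator (Suc j * \<kappa>) u) + l2_norm (\<lambda>n. of_real (G j) * u n)"
      unfolding d_def by (intro l2_norm_diff_le commutator_l2 l2_scale) simp_all
    also have "\<dots> \<le> 2 * l2_norm u + 2 * l2_norm u"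
      using G2[of j] by (intro add_mono commutator_norm_le) (simp_all add: l2_norm_scale mult_right_mono)
    finally show ?thesis by simp
  qed
  have partial: "l2_norm (\<lambda>n. \<Sum>j<J. of_real (\<rho> (Suc j)) * d j n) \<le> \<epsilon> * l2_norm u" for J
  proof -
    have "l2_norm (\<lambda>n. \<Sum>j<J. of_real (\<rho> (Suc j)) * d j n) \<le> (\<Sum>j<J. r j * l2_norm (d j))"
      using l2_sum(2)[of "{..<J}" "\<lambda>j n. of_real (\<rho> (Suc j)) * d j n"]
      by (simp add: l2_scale l2_norm_scale r_def)
    also have "\<dots> \<le> (\<Sum>j\<in>{..<J0} \<union> {J0..<J}. r j * l2_norm (d j))"
      using r0 by (intro sum_mono2) auto
    also have "\<dots> = (\<Sum>j<J0. r j * l2_norm (d j)) + (\<Sum>j=J0..<J. r j * l2_norm (d j))"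
      by (rule sum.union_disjoint) auto
    also have "\<dots> \<le> (\<Sum>j<J0. r j * (K j * e * l2_norm u)) + (\<Sum>j=J0..<J. r j * (4 * l2_norm u))"
      using r0 d1 d2 by (intro add_mono sum_mono mult_left_mono) auto
    also have "\<dots> = M * e * l2_norm u + 4 * sum r {J0..<J} * l2_norm u"
      by (simp add: M_def sum_distrib_left sum_distrib_right mult_ac)
    also have "\<dots> \<le> \<epsilon> / 2 * l2_norm u + \<epsilon> / 2 * l2_norm u"
      using e(3) tail[of J] by (intro add_mono mult_right_mono) auto
    finally show ?thesis by simp
  qed
  have "(\<lambda>J. \<Sum>j<J. of_real (\<rho> (Suc j)) * d j n)
      \<longlonglongrightarrow> B u n - of_real (\<Sum>j. \<rho> (Suc j) * G j) * u n" for n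
  proof -
    have "(\<lambda>J. (\<Sum>j<J. of_real (\<rho> (Suc j)) * commutator (Suc j * \<kappa>) u n)
        - of_real (\<Sum>j<J. \<rho> (Suc j) * G j) * u n)
      \<longlonglongrightarrow> B u n - of_real (\<Sum>j. \<rho> (Suc j) * G j) * u n"
      by (intro tendsto_intros commutator_pointwise[OF A B u(1)] summable_LIMSEQ sG)
    then show ?thesis
      by (simp add: d_def right_diff_distrib sum_subtractf sum_distrib_right mult.assoc)
  qed
  from l2_norm_le_pointwise_limit[OF this _ partial]
  have "l2_norm (\<lambda>n. B u n - of_real (\<Sum>j. \<rho> (Suc j) * G j) * u n) \<le> \<epsilon> * l2_norm u"
    by (simp add: l2_sum(1) l2_scale)
  moreover have "l2_norm (\<lambda>n. MV u n - of_real (x $ 1 * x $ 2) * u n) \<le> \<epsilon> * l2_norm u"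
    using MV_approx[OF ul2 wave x] mult_right_mono[OF e(2) l2_norm_ge_0[of u]] by simp
  ultimately show thesis using that u unfolding G_def by blast
qed

lemma cos_coordinates:
  fixes x :: "real ^ 2"
  assumes "x \<in> energy_surface E"
  obtains t where "\<And>i. x $ i = cos (t i)" and "x $ 1 * x $ 2 = E"
proof
  show "x $ i = cos (arccos (x $ i))" for i
    using assms by (simp add: energy_surface_def cos_arccos)
  show "x $ 1 * x $ 2 = E"
    using assms by (simp add: energy_surface_def UNIV_2)
qed

text \<open>A bounded inverse of \<open>MV - E\<close> is incompatible with approximate eigenvectors at \<open>E\<close>.\<close>

lemma energy_in_spectrum:
  fixes x :: "real ^ 2"
  assumes "x \<in> energy_surface E"
  shows "E \<in> real_spectrum (MV :: 2 op)"
proof -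
  obtain t where x: "\<And>i. x $ i = cos (t i)" "x $ 1 * x $ 2 = E"
    using cos_coordinates[OF assms] by blast
  have False if R: "bounded_op R"
    "\<And>u. u \<in> l2 \<Longrightarrow> R (\<lambda>n. MV u n - of_real E * u n) = u" for R :: "2 op"
  proof -
    obtain C where C: "0 \<le> C" "\<And>u. u \<in> l2 \<Longrightarrow> l2_norm (R u) \<le> C * l2_norm u"
      using bounded_op_bound[OF R(1)] by blast
    define e where "e = 1 / (4 * (C + 1))"
    have e: "e > 0" "C * (2 * e) < 1" using C(1) by (auto simp: e_def field_simps)
    obtain u :: "2 seq" where u: "u \<in> fin_supp" "0 < l2_norm u"
      and wave: "\<And>i. l2_norm (\<lambda>n. shift i 1 u n - cis (- t i) * u n) \<le> e * l2_norm u"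
      using plane_wave_approx[OF e(1), of t] by blast
    note ul2 = fin_supp_l2[OF u(1)]
    let ?y = "\<lambda>n. MV u n - of_real E * u n"
    have "l2_norm u \<le> C * l2_norm ?y"
      using C(2)[of ?y] R(2)[OF ul2] ul2 bounded_op_l2[OF MV_bounded] by (simp add: l2_diff l2_scale)
    also have "\<dots> \<le> C * (2 * (e * l2_norm u))"
      using MV_approx[OF ul2 wave x(1)] C(1) unfolding x(2) by (intro mult_left_mono)
    also have "\<dots> = C * (2 * e) * l2_norm u" by simp
    also have "\<dots> < 1 * l2_norm u" using e(2) u(2) by (rule mult_strict_right_mono)
    finally show False by simp
  qed
  then show ?thesis unfolding real_spectrum_def by blast
qed

text \<open>A Mourre estimate at \<open>E\<close> makes the absolutely convergent series
  \<open>\<Sum>j. \<rho> (Suc j) * g (Suc j * \<kappa>) x\<close> positive at every point of the energy surface, which contradicts a relation with nonpositive weights between its values.\<close>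

lemma Theta_m_subset_Theta:
  assumes \<kappa>: "\<kappa> > 0"
  shows "Theta_m TYPE(2) m \<kappa> \<subseteq> Theta TYPE(2) \<kappa>"
proof
  fix E assume "E \<in> Theta_m TYPE(2) m \<kappa>"
  then obtain x :: "nat \<Rightarrow> real ^ 2" and \<omega> where x: "\<And>q. q \<le> m \<Longrightarrow> x q \<in> energy_surface E"
    and \<omega>: "\<And>q. q < m \<Longrightarrow> \<omega> q \<le> 0"
    and rel: "\<And>j. j \<ge> 1 \<Longrightarrow> g (j * \<kappa>) (x m) = (\<Sum>q<m. \<omega> q * g (j * \<kappa>) (x q))"
    unfolding Theta_m_def by blast
  have "E \<notin> mourre_set TYPE(2) \<kappa>"
  proof
    assume "E \<in> mourre_set TYPE(2) \<kappa>"
    then obtain \<rho> and A B Q :: "2 op" and a b \<gamma> where A: "conj_comb \<kappa> \<rho> A"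
      and B: "commutator_ext MV A B" and E: "a < E" "E < b" and Q: "spectral_proj MV {a<..<b} Q"
      and \<gamma>: "\<gamma> > 0" and le: "op_le (\<lambda>u n. of_real \<gamma> * Q u n) (Q \<circ> B \<circ> Q)"
      unfolding mourre_set_def by blast
    define G where "G = (\<lambda>x :: real ^ 2. \<Sum>j. \<rho> (Suc j) * g (Suc j * \<kappa>) x)"
    have Bb: "bounded_op B" using B unfolding commutator_ext_def by blast
    have pos: "\<gamma> \<le> G (x q)" if q: "q \<le> m" for q
    proof (rule mourre_constant_le[OF MV_bounded MV_symmetric Bb Q E le])
      fix \<epsilon> :: real assume "\<epsilon> > 0"
      obtain t where t: "\<And>i. x q $ i = cos (t i)" "x q $ 1 * x q $ 2 = E"
        using cos_coordinates[OF x[OF q]] by blast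
      obtain u where "u \<in> fin_supp" "0 < l2_norm u"
        "l2_norm (\<lambda>n. MV u n - of_real E * u n) \<le> \<epsilon> * l2_norm u"
        "l2_norm (\<lambda>n. B u n - of_real (G (x q)) * u n) \<le> \<epsilon> * l2_norm u"
        using mourre_commutator_approx[OF \<kappa> A B t(1) \<open>\<epsilon> > 0\<close>] unfolding t(2) G_def by blast
      then show "\<exists>u\<in>l2. 0 < l2_norm u \<and>
          l2_norm (\<lambda>n. MV u n - of_real E * u n) \<le> \<epsilon> * l2_norm u \<and>
          l2_norm (\<lambda>n. B u n - of_real (G (x q)) * u n) \<le> \<epsilon> * l2_norm u"
        using fin_supp_l2 by blast
    qed
    have summ: "summable (\<lambda>j. \<rho> (Suc j) * g (Suc j * \<kappa>) (x q))" if q: "q \<le> m" for q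
    proof -
      obtain t where t: "\<And>i. x q $ i = cos (t i)" using cos_coordinates[OF x[OF q]] by blast
      have "\<bar>g (Suc j * \<kappa>) (x q)\<bar> \<le> 2" for j by (rule abs_g_le[OF t]) (use \<kappa> in simp)
      from mult_left_mono[OF this abs_ge_zero]
      have "norm (\<rho> (Suc j) * g (Suc j * \<kappa>) (x q)) \<le> 2 * \<bar>\<rho> (Suc j)\<bar>" for j
        by (simp only: real_norm_def abs_mult mult.commute[of "2 :: real"])
      then show ?thesis
        by (rule summable_comparison_test'[OF summable_mult[OF conj_comb_summable[OF \<kappa> A], of 2]])
    qed
    have "\<rho> (Suc j) * g (Suc j * \<kappa>) (x m) = (\<Sum>q<m. \<omega> q * (\<rho> (Suc j) * g (Suc j * \<kappa>) (x q)))" for j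
    proof -
      have "g (Suc j * \<kappa>) (x m) = (\<Sum>q<m. \<omega> q * g (Suc j * \<kappa>) (x q))" by (rule rel) simp
      then show ?thesis by (simp only: sum_distrib_left mult.left_commute)
    qed
    then have "G (x m) = (\<Sum>j. \<Sum>q<m. \<omega> q * (\<rho> (Suc j) * g (Suc j * \<kappa>) (x q)))"
      unfolding G_def by (simp only:)
    also have "\<dots> = (\<Sum>q<m. \<Sum>j. \<omega> q * (\<rho> (Suc j) * g (Suc j * \<kappa>) (x q)))"
      by (rule suminf_sum, intro summable_mult summ) simp
    also have "\<dots> = (\<Sum>q<m. \<omega> q * G (x q))"
      unfolding G_def by (intro sum.cong refl suminf_mult summ) auto
    also have "\<dots> \<le> 0"
      by (intro sum_nonpos mult_nonpos_nonneg) (use \<omega> pos \<gamma> in \<open>auto intro: order_trans[of 0 \<gamma>]\<close>)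
    finally show False using pos[of m] \<gamma> by simp
  qed
  then show "E \<in> Theta TYPE(2) \<kappa>"
    using energy_in_spectrum[OF x[of m]] unfolding Theta_def by simp
qed

section \<open>Chains of reflected angles\<close>

text \<open>The angle \<open>e\<close> following \<open>chain_angle h E q\<close> makes the point with coordinates
  \<open>cos (h - chain_angle h E q)\<close> and \<open>cos e\<close> lie on the energy surface. Capping the reflected angle
  at \<open>0\<close> keeps the recursion well defined, continuous in \<open>E\<close> and nondecreasing in \<open>q\<close> also
  past the range in which it describes points of a chain; only so can the intermediate value
  theorem be applied on a whole interval of energies.\<close>

fun chain_angle :: "real \<Rightarrow> real \<Rightarrow> nat \<Rightarrow> real" where
  "chain_angle h E 0 = 0"
| "chain_angle h E (Suc q) = arccos (E / cos (max (h - chain_angle h E q) 0))"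

lemmas chain_angle_Suc = chain_angle.simps(2)

declare chain_angle_Suc [simp del]

text \<open>Among pairs of nonnegative angles with sum \<open>h\<close> the product of cosines is least at the ends. This
  is why an energy below \<open>cos h\<close> makes the angles of a chain move.\<close>

lemma cos_le_cos_mult_cos_reflected:
  assumes "0 \<le> e" and "e \<le> h" and "h \<le> pi"
  shows "cos h \<le> cos e * cos (h - e)"
proof -
  have "cos h \<le> cos \<bar>h - 2 * e\<bar>"
    using assms by (intro cos_monotone_0_pi_le) auto
  moreover have "cos e * cos (h - e) = (cos h + cos (h - 2 * e)) / 2"
    using cos_times_cos[of "h - e" e] by (simp add: algebra_simps)
  ultimately show ?thesis by simp
qed

context
  fixes h :: real
  assumes h: "0 < h" "h < pi / 2"
begin

abbreviation "ang \<equiv> chain_angle h"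

lemma cos_h: "0 < cos h" "cos h < 1"
  using h cos_gt_zero cos_monotone_0_pi[of 0 h] by auto

lemma cos_capped:
  assumes "0 \<le> e"
  shows "cos h \<le> cos (max (h - e) 0)" and "0 < cos (max (h - e) 0)" and "cos (max (h - e) 0) \<le> 1"
proof -
  show "cos h \<le> cos (max (h - e) 0)"
    using assms h by (intro cos_monotone_0_pi_le) auto
  then show "0 < cos (max (h - e) 0)" using cos_h by linarith
qed simp

lemma quotient_bounds:
  assumes "0 \<le> e" and "0 < E" and "E \<le> cos h"
  shows "0 < E / cos (max (h - e) 0)" and "E / cos (max (h - e) 0) \<le> 1"
  using cos_capped[OF assms(1)] assms(2,3) by auto

lemma ang_bounds:
  assumes "0 < E" and "E \<le> cos h"
  shows "0 \<le> ang E q" and "ang E q < pi / 2"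
proof -
  have "0 \<le> ang E q \<and> ang E q < pi / 2"
  proof (induction q)
    case 0
    then show ?case by simp
  next
    case (Suc q)
    let ?x = "E / cos (max (h - ang E q) 0)"
    have x: "0 < ?x" "?x \<le> 1" using quotient_bounds[OF _ assms] Suc by auto
    then have "arccos ?x < arccos 0" by (intro arccos_less_arccos) auto
    then show ?case using x by (auto simp: chain_angle_Suc intro: arccos_lbound)
  qed
  then show "0 \<le> ang E q" and "ang E q < pi / 2" by auto
qed

lemma cos_ang_Suc:
  assumes "0 < E" and "E \<le> cos h"
  shows "cos (ang E (Suc q)) = E / cos (max (h - ang E q) 0)"
  using quotient_bounds[OF ang_bounds(1)[OF assms] assms, of q] by (simp add: chain_angle_Suc)

lemma continuous_on_ang: "continuous_on {0<..cos h} (\<lambda>E. ang E q)"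
proof (induction q)
  case 0
  then show ?case by simp
next
  case (Suc q)
  have b: "cos (max (h - ang E q) 0) \<noteq> 0" "- 1 \<le> E / cos (max (h - ang E q) 0)"
    "E / cos (max (h - ang E q) 0) \<le> 1" if "E \<in> {0<..cos h}" for E
  proof -
    have E: "0 < E" "E \<le> cos h" using that by auto
    show "cos (max (h - ang E q) 0) \<noteq> 0" using cos_capped(2)[OF ang_bounds(1)[OF E], of q] by simp
    show "- 1 \<le> E / cos (max (h - ang E q) 0)" "E / cos (max (h - ang E q) 0) \<le> 1"
      using quotient_bounds[OF ang_bounds(1)[OF E] E, of q] by linarith+
  qed
  show ?case
    unfolding chain_angle_Suc
    by (intro continuous_intros Suc ballI conjI) (use b in auto)
qed

lemma ang_cos_h: "ang (cos h) q = 0"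
  using cos_h h by (induction q) (auto simp: chain_angle_Suc)

text \<open>With \<open>e = ang E q\<close>, the surplus \<open>cos e * cos (h - e) - E\<close> is at least \<open>cos h - E\<close>, and the drop of
  the cosine is this surplus divided by \<open>cos (h - e) \<le> 1\<close>.\<close>

lemma cos_ang_decrease:
  assumes "0 < E" and "E \<le> cos h" and "ang E q \<le> h"
  shows "cos (ang E (Suc q)) \<le> cos (ang E q) - (cos h - E)"
proof -
  let ?e = "ang E q"
  note e0 = ang_bounds(1)[OF assms(1,2), of q]
  have c: "0 < cos (h - ?e)" "cos (h - ?e) \<le> 1" using cos_capped[OF e0] assms(3) by auto
  have "cos h - E \<le> (cos h - E) / cos (h - ?e)"
    using c assms(2) by (simp add: pos_le_divide_eq mult_left_le)
  also have "\<dots> \<le> (cos ?e * cos (h - ?e) - E) / cos (h - ?e)"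
    using cos_le_cos_mult_cos_reflected[OF e0 assms(3)] h c by (intro divide_right_mono) auto
  also have "\<dots> = cos ?e - cos (ang E (Suc q))"
    using c assms(3) by (simp only: cos_ang_Suc[OF assms(1,2)] max_absorb1 diff_ge_0_iff_ge diff_divide_distrib)
      simp
  finally show ?thesis by simp
qed

text \<open>Up to \<open>h\<close> the cosine drops; beyond it the cap turns the next cosine into \<open>E\<close>, the least value
  that the recursion can produce.\<close>

lemma ang_le_Suc:
  assumes "0 < E" and "E \<le> cos h"
  shows "ang E q \<le> ang E (Suc q)"
proof -
  note b = ang_bounds[OF assms]
  have "cos (ang E (Suc q)) \<le> cos (ang E q)"
  proof (cases "ang E q \<le> h")
    case True
    then show ?thesis using cos_ang_decrease[OF assms True] assms(2) by linarith
  next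
    case False
    then obtain p where q: "q = Suc p" using h by (cases q) auto
    have "cos (ang E (Suc q)) = E" using False cos_ang_Suc[OF assms, of q] by simp
    moreover have "E \<le> cos (ang E q)"
      unfolding q cos_ang_Suc[OF assms]
      using cos_capped[OF b(1)[of p]] assms(1) by (simp add: pos_le_divide_eq mult_left_le)
    ultimately show ?thesis by simp
  qed
  then show ?thesis
    using cos_mono_le_eq[of "ang E (Suc q)" "ang E q"] b[of q] b[of "Suc q"] by simp
qed

lemma ang_mono: "0 < E \<Longrightarrow> E \<le> cos h \<Longrightarrow> p \<le> q \<Longrightarrow> ang E p \<le> ang E q"
  using lift_Suc_mono_le[of "ang E"] ang_le_Suc by blast

lemma ang_less_Suc:
  assumes "0 < E" and "E < cos h" and "ang E q \<le> h"
  shows "ang E q < ang E (Suc q)"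
proof -
  note E = assms(1) less_imp_le[OF assms(2)]
  have "cos (ang E (Suc q)) < cos (ang E q)"
    using cos_ang_decrease[OF E assms(3)] assms(2) by linarith
  then show ?thesis
    using cos_mono_less_eq[of "ang E (Suc q)" "ang E q"] ang_bounds[OF E, of q] ang_bounds[OF E, of "Suc q"]
    by simp
qed

text \<open>Cosines start at \<open>1\<close>, stay positive and drop by at least \<open>cos h - E\<close> in each step: a long chain needs an
  energy close to \<open>cos h\<close>.\<close>

lemma energy_gap_le:
  assumes "0 < E" and "E \<le> cos h" and "ang E n \<le> h"
  shows "real (Suc n) * (cos h - E) \<le> 1"
proof -
  have "cos (ang E (Suc q)) \<le> 1 - real (Suc q) * (cos h - E)" if "q \<le> n" for q
    using that
  proof (induction q)
    case 0
    then show ?case using cos_ang_decrease[OF assms(1,2), of 0] h by simp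
  next
    case (Suc q)
    have "ang E (Suc q) \<le> h" using ang_mono[OF assms(1,2) Suc.prems] assms(3) by linarith
    from cos_ang_decrease[OF assms(1,2) this] Suc show ?case
      by (simp add: algebra_simps)
  qed
  from this[of n] moreover have "0 < cos (ang E (Suc n))"
    using ang_bounds[OF assms(1,2), of "Suc n"] by (intro cos_gt_zero_pi) auto
  ultimately show ?thesis by simp
qed

text \<open>The two ways to close a chain after the points \<open>0, \<dots>, n\<close>: at the angle \<open>h / 2 = pi / \<kappa>\<close> all sines
  \<open>sin (j * \<kappa> * t)\<close> vanish, and at a point with equal coordinates the new angle is the reflection of
  the old one.\<close>

definition ends_at_half :: "nat \<Rightarrow> real \<Rightarrow> bool" where
  "ends_at_half n E \<longleftrightarrow> 0 < E \<and> E < cos h \<and> ang E (Suc n) = h / 2"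

definition ends_on_diagonal :: "nat \<Rightarrow> real \<Rightarrow> bool" where
  "ends_on_diagonal n E \<longleftrightarrow> 0 < E \<and> E < cos h \<and> ang E n + ang E (Suc n) = h"

lemma ends_at_half_0: "ends_at_half 0 E \<longleftrightarrow> E = cos (h / 2) * cos h"
proof
  assume "ends_at_half 0 E"
  then have E: "0 < E" "E \<le> cos h" "ang E (Suc 0) = h / 2" by (auto simp: ends_at_half_def)
  have "cos (h / 2) = E / cos h"
    using cos_ang_Suc[OF E(1,2), of 0] E(3) h by simp
  then show "E = cos (h / 2) * cos h" using cos_h by simp
next
  assume E: "E = cos (h / 2) * cos h"
  have c: "0 < cos (h / 2)" "cos (h / 2) < 1"
    using h cos_monotone_0_pi[of 0 "h / 2"] by (auto intro: cos_gt_zero)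
  then show "ends_at_half 0 E"
    unfolding ends_at_half_def E using cos_h h by (simp add: arccos_cos chain_angle_Suc)
qed

lemma next_energy:
  assumes E: "0 < E" "E < cos h" and f: "continuous_on {0<..cos h} (f :: real \<Rightarrow> real)"
    and v: "f (cos h) < v" "v < f E"
  obtains E' where "E < E'" and "E' < cos h" and "f E' = v"
proof -
  have "continuous_on {E..cos h} f" using f by (rule continuous_on_subset) (use E in auto)
  then obtain E' where "E \<le> E'" "E' \<le> cos h" "f E' = v"
    using IVT2'[of f "cos h" v E] v E by auto
  moreover have "E' \<noteq> E" "E' \<noteq> cos h" using v \<open>f E' = v\<close> by auto
  ultimately show thesis using that by force
qed

text \<open>At \<open>E\<close> the two angles sum to more than \<open>h\<close>, because the second one exceeds \<open>h / 2\<close>; at \<open>cos h\<close>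
  all angles vanish.\<close>

lemma next_diagonal:
  assumes "ends_at_half n E"
  shows "\<exists>E'>E. ends_on_diagonal (Suc n) E'"
proof -
  have E: "0 < E" "E < cos h" "ang E (Suc n) = h / 2" using assms by (auto simp: ends_at_half_def)
  have "h / 2 < ang E (Suc (Suc n))" using ang_less_Suc[OF E(1,2), of "Suc n"] E(3) h by simp
  then have "h < ang E (Suc n) + ang E (Suc (Suc n))" using E(3) by simp
  moreover have "ang (cos h) (Suc n) + ang (cos h) (Suc (Suc n)) < h"
    unfolding ang_cos_h using h by simp
  moreover have "continuous_on {0<..cos h} (\<lambda>E. ang E (Suc n) + ang E (Suc (Suc n)))"
    by (intro continuous_on_add continuous_on_ang)
  ultimately obtain E' where "E < E'" "E' < cos h" "ang E' (Suc n) + ang E' (Suc (Suc n)) = h"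
    using next_energy[OF E(1,2), of "\<lambda>E. ang E (Suc n) + ang E (Suc (Suc n))" h] by blast
  then show ?thesis unfolding ends_on_diagonal_def using E(1) by (intro exI[of _ E']) auto
qed

lemma ends_on_diagonal_le:
  assumes "ends_on_diagonal n E"
  shows "ang E n \<le> h / 2"
  using assms ang_le_Suc[of E n] unfolding ends_on_diagonal_def by auto

lemma next_half:
  assumes "ends_on_diagonal n E"
  shows "\<exists>E'>E. ends_at_half n E'"
proof -
  have E: "0 < E" "E < cos h" "ang E n + ang E (Suc n) = h" using assms by (auto simp: ends_on_diagonal_def)
  have "ang E n < ang E (Suc n)" using ang_less_Suc[OF E(1,2)] ends_on_diagonal_le[OF assms] h by simp
  then have "h / 2 < ang E (Suc n)" using E(3) by simp
  moreover have "ang (cos h) (Suc n) < h / 2" unfolding ang_cos_h using h by simp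
  ultimately obtain E' where "E < E'" "E' < cos h" "ang E' (Suc n) = h / 2"
    using next_energy[OF E(1,2) continuous_on_ang, of "Suc n" "h / 2"] by blast
  then show ?thesis unfolding ends_at_half_def using E(1) by (intro exI[of _ E']) auto
qed

text \<open>The energies of the two kinds, interleaved. Number \<open>0\<close> is the left end of the interval, which
  serves only to start the construction.\<close>

definition chain_energy :: "nat \<Rightarrow> real \<Rightarrow> bool" where
  "chain_energy m E \<longleftrightarrow> (if even m then ends_at_half (m div 2) E else ends_on_diagonal (Suc m div 2) E)"

lemma energies_exist:
  obtains F where "F 0 = cos (h / 2) * cos h" and "\<And>m. chain_energy m (F m)" and "\<And>m. F m < F (Suc m)"
proof -
  have "\<exists>F. \<forall>m. chain_energy m (F m) \<and> F m < F (Suc m)"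
  proof (rule dependent_nat_choice)
    show "\<exists>E. chain_energy 0 E" by (simp add: chain_energy_def ends_at_half_0)
    fix E m assume E: "chain_energy m E"
    show "\<exists>E'. chain_energy (Suc m) E' \<and> E < E'"
    proof (cases "even m")
      case True
      then have "ends_at_half (m div 2) E" using E by (simp add: chain_energy_def)
      from next_diagonal[OF this] show ?thesis using True by (auto simp: chain_energy_def)
    next
      case False
      then have "ends_on_diagonal (Suc m div 2) E" using E by (simp add: chain_energy_def)
      from next_half[OF this] show ?thesis using False by (auto simp: chain_energy_def)
    qed
  qed
  then obtain F where F: "\<And>m. chain_energy m (F m)" "\<And>m. F m < F (Suc m)" by blast
  moreover have "F 0 = cos (h / 2) * cos h"
    using F(1)[of 0] by (simp add: chain_energy_def ends_at_half_0)
  ultimately show thesis using that by blast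
qed

lemma ends_at_half_le: "ends_at_half n E \<Longrightarrow> ang E n \<le> h / 2"
  unfolding ends_at_half_def using ang_le_Suc[of E n] by auto

lemma chain_energy_bounds:
  assumes "chain_energy m E"
  shows "0 < E" and "E < cos h" and "real (Suc m) * (cos h - E) \<le> 2"
proof -
  define n where "n = (if even m then m div 2 else Suc m div 2)"
  have E: "0 < E \<and> E < cos h \<and> ang E n \<le> h / 2"
    using assms ends_at_half_le ends_on_diagonal_le
    unfolding chain_energy_def n_def by (auto simp: ends_at_half_def ends_on_diagonal_def split: if_splits)
  then show "0 < E" "E < cos h" by auto
  have "real (Suc n) * (cos h - E) \<le> 1" using E h by (intro energy_gap_le) auto
  moreover have "real (Suc m) * (cos h - E) \<le> (2 * real (Suc n)) * (cos h - E)"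
    using E by (intro mult_right_mono) (auto simp: n_def)
  moreover have "(2 * real (Suc n)) * (cos h - E) = 2 * (real (Suc n) * (cos h - E))" by simp
  ultimately show "real (Suc m) * (cos h - E) \<le> 2" by linarith
qed

lemma energies_tendsto:
  assumes "\<And>m. chain_energy m (F m)"
  shows "F \<longlonglongrightarrow> cos h"
proof -
  have "norm (F m - cos h) \<le> 2 * inverse (real (Suc m))" for m
    using chain_energy_bounds[OF assms[of m]] by (simp add: field_simps del: of_nat_Suc)
  moreover have "(\<lambda>m. 2 * inverse (real (Suc m))) \<longlonglongrightarrow> 0"
    using tendsto_mult_right_zero[OF LIMSEQ_inverse_real_of_nat, of 2] by simp
  ultimately have "(\<lambda>m. F m - cos h) \<longlonglongrightarrow> 0"
    by (rule Lim_null_comparison[OF always_eventually[OF allI]])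
  then show ?thesis by (simp add: LIM_zero_iff)
qed

definition chain_point :: "real \<Rightarrow> nat \<Rightarrow> real ^ 2" where
  "chain_point E q = vector [cos (h - ang E q), cos (ang E (Suc q))]"

context
  fixes E :: real and \<kappa> :: nat
  assumes E: "0 < E" "E < cos h" and \<kappa>: "\<kappa> > 0" "real \<kappa> * h = 2 * pi"
begin

lemma chain_point_energy_surface:
  assumes "ang E q \<le> h"
  shows "chain_point E q \<in> energy_surface E"
proof -
  have "cos (h - ang E q) * cos (ang E (Suc q)) = E"
    using assms cos_ang_Suc[of E q] cos_capped(2)[OF ang_bounds(1)[of E q]] E by simp
  then show ?thesis
    by (simp add: energy_surface_def chain_point_def UNIV_2 forall_2)
qed

text \<open>The reflection \<open>t \<mapsto> h - t\<close> changes the sign of \<open>sin (j * \<kappa> * t)\<close> for every \<open>j\<close> at the same time,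
  since \<open>j * \<kappa> * h\<close> is a multiple of \<open>2 * pi\<close>.\<close>

lemma g_chain_point:
  assumes "j \<ge> 1"
  shows "g (j * \<kappa>) (chain_point E q)
    = cos (h - ang E q) * sin (ang E (Suc q)) * sin (real (j * \<kappa>) * ang E (Suc q))
    - cos (ang E (Suc q)) * sin (h - ang E q) * sin (real (j * \<kappa>) * ang E q)"
proof -
  define t where "t = (\<lambda>i :: 2. if i = 1 then h - ang E q else ang E (Suc q))"
  have t: "chain_point E q $ i = cos (t i)" for i
    using exhaust_2[of i] by (auto simp: chain_point_def t_def)
  have "real (j * \<kappa>) * h = 2 * real j * pi" using \<kappa>(2) by (simp add: mult.assoc mult.commute)
  then have "sin (real (j * \<kappa>) * (h - ang E q)) = sin (2 * real j * pi - real (j * \<kappa>) * ang E q)"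
    by (simp only: right_diff_distrib)
  also have "\<dots> = - sin (real (j * \<kappa>) * ang E q)"
    by (simp add: sin_diff sin_2npi cos_2npi)
  finally have refl: "sin (real (j * \<kappa>) * (h - ang E q)) = - sin (real (j * \<kappa>) * ang E q)" .
  have "j * \<kappa> \<ge> 1" using assms \<kappa>(1) by (simp add: Suc_le_eq)
  from g_cos[OF t this] show ?thesis by (simp add: t_def refl del: of_nat_mult)
qed

lemma chain_weights_nonneg:
  assumes "ang E q \<le> h"
  shows "0 < cos (h - ang E q) * sin (ang E (Suc q))" and "0 \<le> cos (ang E (Suc q)) * sin (h - ang E q)"
proof -
  note b = ang_bounds[OF E(1) less_imp_le[OF E(2)]]
  have "0 < ang E (Suc q)" using ang_less_Suc[OF E assms] b(1)[of q] by linarith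
  then have "0 < sin (ang E (Suc q))" "0 < cos (ang E (Suc q))"
    using b(2)[of "Suc q"] by (auto intro!: sin_gt_zero cos_gt_zero)
  moreover have "0 < cos (h - ang E q)" "0 \<le> sin (h - ang E q)"
    using b(1)[of q] assms h by (auto intro!: sin_ge_zero cos_gt_zero_pi)
  ultimately show "0 < cos (h - ang E q) * sin (ang E (Suc q))"
    and "0 \<le> cos (ang E (Suc q)) * sin (h - ang E q)" by simp_all
qed

text \<open>By \<open>g_chain_point\<close> each sine is a combination with nonnegative weights, independent of \<open>j\<close>, of the
  preceding sine and one value of \<open>g\<close>; the first sine is \<open>0\<close>.\<close>

lemma sine_in_chain_cone:
  assumes "\<And>q. q < n \<Longrightarrow> ang E q \<le> h"
  shows "\<exists>c. (\<forall>q. 0 \<le> c q) \<and>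
    (\<forall>j\<ge>1. sin (real (j * \<kappa>) * ang E n) = (\<Sum>q<n. c q * g (j * \<kappa>) (chain_point E q)))"
  using assms
proof (induction n)
  case 0
  then show ?case by (auto intro: exI[of _ "\<lambda>_. 0"])
next
  case (Suc n)
  then obtain c where c: "\<And>q. 0 \<le> c q"
    "\<And>j. j \<ge> 1 \<Longrightarrow> sin (real (j * \<kappa>) * ang E n) = (\<Sum>q<n. c q * g (j * \<kappa>) (chain_point E q))"
    by (metis less_Suc_eq)
  define a b where "a = cos (ang E (Suc n)) * sin (h - ang E n)" and "b = cos (h - ang E n) * sin (ang E (Suc n))"
  have ab: "0 \<le> a" "0 < b"
    unfolding a_def b_def using chain_weights_nonneg[OF Suc.prems, of n] by auto
  have "sin (real (j * \<kappa>) * ang E (Suc n))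
      = (\<Sum>q<Suc n. (if q = n then 1 / b else a / b * c q) * g (j * \<kappa>) (chain_point E q))"
    if j: "j \<ge> 1" for j
  proof -
    have "sin (real (j * \<kappa>) * ang E (Suc n))
        = (g (j * \<kappa>) (chain_point E n) + a * sin (real (j * \<kappa>) * ang E n)) / b"
      unfolding g_chain_point[OF j] a_def[symmetric] b_def[symmetric] using ab
      by (simp add: field_simps)
    then show ?thesis
      unfolding c(2)[OF j]
      by (simp add: sum_distrib_left add_divide_distrib sum_divide_distrib mult_ac)
  qed
  moreover have "0 \<le> (if q = n then 1 / b else a / b * c q)" for q using ab c(1) by simp
  ultimately show ?case by (intro exI[of _ "\<lambda>q. if q = n then 1 / b else a / b * c q"]) blast
qed

lemma chain_closes:
  assumes le: "ang E n \<le> h" and w: "0 \<le> w"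
    and last: "\<And>j. j \<ge> 1 \<Longrightarrow> g (j * \<kappa>) (chain_point E n) = - w * sin (real (j * \<kappa>) * ang E n)"
  shows "E \<in> Theta_m TYPE(2) n \<kappa>"
proof -
  have le': "ang E q \<le> h" if "q \<le> n" for q
    using ang_mono[OF E(1) less_imp_le[OF E(2)] that] le by linarith
  obtain c where c: "\<And>q. 0 \<le> c q"
    "\<And>j. j \<ge> 1 \<Longrightarrow> sin (real (j * \<kappa>) * ang E n) = (\<Sum>q<n. c q * g (j * \<kappa>) (chain_point E q))"
    using sine_in_chain_cone[of n, OF le'[OF less_imp_le]] by blast
  have "\<forall>q\<le>n. chain_point E q \<in> energy_surface E"
    using chain_point_energy_surface le' by blast
  moreover have "\<forall>q<n. - w * c q \<le> 0" using w c(1) by simp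
  moreover have "\<forall>j\<ge>1. g (j * \<kappa>) (chain_point E n) = (\<Sum>q<n. (- w * c q) * g (j * \<kappa>) (chain_point E q))"
    by (intro allI impI) (simp only: last c(2) sum_distrib_left mult.assoc)
  moreover have "E \<in> {-1..1}" using E cos_h by simp
  ultimately show ?thesis
    unfolding Theta_m_def mem_Collect_eq
    by (intro conjI exI[of _ "chain_point E"] exI[of _ "\<lambda>q. - w * c q"])
qed

lemma ends_at_half_Theta_m:
  assumes "ends_at_half n E"
  shows "E \<in> Theta_m TYPE(2) n \<kappa>"
proof -
  have le: "ang E n \<le> h" using ends_at_half_le[OF assms] h by simp
  have half: "ang E (Suc n) = h / 2" using assms by (simp add: ends_at_half_def)
  have "sin (real (j * \<kappa>) * (h / 2)) = 0" for j
  proof -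
    have "real (j * \<kappa>) * (h / 2) = real j * (real \<kappa> * h) / 2"
      by (simp only: of_nat_mult times_divide_eq_right mult.assoc)
    also have "\<dots> = real j * pi" unfolding \<kappa>(2) by simp
    finally show ?thesis by (simp only: sin_npi)
  qed
  then show ?thesis
    by (intro chain_closes[OF le chain_weights_nonneg(2)[OF le]])
      (simp add: g_chain_point half del: of_nat_mult)
qed

lemma ends_on_diagonal_Theta_m:
  assumes "ends_on_diagonal n E"
  shows "E \<in> Theta_m TYPE(2) n \<kappa>"
proof -
  have le: "ang E n \<le> h" using ends_on_diagonal_le[OF assms] h by simp
  have diag: "ang E (Suc n) = h - ang E n" using assms by (simp add: ends_on_diagonal_def)
  have refl: "sin (real (j * \<kappa>) * (h - ang E n)) = - sin (real (j * \<kappa>) * ang E n)" for j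
  proof -
    have "real (j * \<kappa>) * h = 2 * real j * pi" using \<kappa>(2) by (simp add: mult.assoc mult.commute)
    then have "sin (real (j * \<kappa>) * (h - ang E n)) = sin (2 * real j * pi - real (j * \<kappa>) * ang E n)"
      by (simp only: right_diff_distrib)
    then show ?thesis by (simp add: sin_diff sin_2npi cos_2npi)
  qed
  show ?thesis
  proof (rule chain_closes[OF le])
    show "0 \<le> cos (h - ang E n) * sin (ang E (Suc n)) + cos (ang E (Suc n)) * sin (h - ang E n)"
      using chain_weights_nonneg[OF le] by linarith
    fix j :: nat assume j: "j \<ge> 1"
    show "g (j * \<kappa>) (chain_point E n)
      = - (cos (h - ang E n) * sin (ang E (Suc n)) + cos (ang E (Suc n)) * sin (h - ang E n))
        * sin (real (j * \<kappa>) * ang E n)"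
      unfolding g_chain_point[OF j] diag refl by (simp add: algebra_simps)
  qed
qed

end

end

section \<open>The threshold sequence\<close>

theorem theorem1p10:
  fixes \<kappa> :: nat
  assumes "\<kappa> \<ge> 6" and "even \<kappa>"
  shows "\<exists>F :: nat \<Rightarrow> real.
    strict_mono_on {1..} F \<and>
    (\<forall>n\<ge>1. F n \<in> {cos (pi / real \<kappa>) * cos (2 * pi / real \<kappa>) <..< cos (2 * pi / real \<kappa>)}
                  \<inter> Theta TYPE(2) \<kappa>) \<and>
    F \<longlonglongrightarrow> cos (2 * pi / real \<kappa>) \<and>
    (\<forall>n\<ge>1. F (2 * n - 1) \<in> Theta_m TYPE(2) n \<kappa> \<and> F (2 * n) \<in> Theta_m TYPE(2) n \<kappa>)"
proof -
  define h where "h = 2 * pi / real \<kappa>"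
  have \<kappa>: "\<kappa> > 0" "real \<kappa> * h = 2 * pi" using assms(1) by (auto simp: h_def)
  have h: "0 < h" "h < pi / 2" using assms(1) by (auto simp: h_def field_simps)
  have half: "pi / real \<kappa> = h / 2" by (simp add: h_def)
  obtain F where F0: "F 0 = cos (h / 2) * cos h" and step: "\<And>m. chain_energy h m (F m)"
    and less: "\<And>m. F m < F (Suc m)"
    using energies_exist[OF h] by blast
  note b = chain_energy_bounds(1,2)[OF h step]
  have even: "F (2 * n) \<in> Theta_m TYPE(2) n \<kappa>" for n
    using step[of "2 * n"] by (intro ends_at_half_Theta_m[OF h b \<kappa>]) (simp add: chain_energy_def[OF h])
  have odd: "F (2 * n - 1) \<in> Theta_m TYPE(2) n \<kappa>" if "n \<ge> 1" for n
    using step[of "2 * n - 1"] that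
    by (intro ends_on_diagonal_Theta_m[OF h b \<kappa>]) (simp add: chain_energy_def[OF h])
  have "F n \<in> Theta TYPE(2) \<kappa>" if "n \<ge> 1" for n
  proof -
    have "n = 2 * (n div 2) \<or> n = 2 * (Suc n div 2) - 1 \<and> Suc n div 2 \<ge> 1" using that by presburger
    then obtain m where "F n \<in> Theta_m TYPE(2) m \<kappa>"
      using even[of "n div 2"] odd[of "Suc n div 2"] by metis
    then show ?thesis using Theta_m_subset_Theta[OF \<kappa>(1)] by blast
  qed
  moreover have "F 0 < F n" if "n \<ge> 1" for n
    using that by (intro lift_Suc_mono_less[of F, OF less]) simp
  moreover have "strict_mono_on {1..} F"
    by (intro strict_mono_onI lift_Suc_mono_less[of F, OF less])
  moreover have "F \<longlonglongrightarrow> cos h" by (rule energies_tendsto[OF h step])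
  ultimately show ?thesis
    unfolding half h_def[symmetric] using F0 b(2) even odd by (intro exI[of _ F]) (simp add: mult.commute)
qed

end
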